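(* Let $T$ be a countably series-parallel partially ordered set and $\mu$ a finite non-negative measure on $T$. Let $R$ be the radius of convergence of $P^{\le}_\mu(Z)$. Then either $T$ is a total order, or $T$ is a countable series composition or a countable parallel composition (of countably series-parallel partial orders). (i) If $T$ is a total order and $\mu$ is non-degenerate, with atoms $\mathcal{A}$, atom masses $m_\alpha$ and diffuse mass $m_d$, then $P^{<}_\mu(z)=e^{m_dz}\prod_{\alpha\in\mathcal{A}}(1+m_\alpha z)$ for all $z\in\mathbb{C}$ and $P^{\le}_\mu(z)=e^{m_dz}\prod_{\alpha\in\mathcal{A}}\frac1{1-m_\alpha z}$ for $|z|\le\frac1{\|\mu\|}$. (ii) If $T=\bigotimes_{\gamma\in\Gamma}T_\gamma$ is a countable series composition, then for all $z\in\mathbb{C}$ $$P^{<}_\mu(z)=\prod_{\gamma\in\Gamma}P^{<}_{\mu|_{T_\gamma}}(z),\qquad\text{and when }|z|<R,\quad P^{\le}_\mu(z)=\prod_{\gamma\in\Gamma}P^{\le}_{\mu|_{T_\gamma}}(z),$$ where $\mu|_{T_\gamma}$ is the restriction of $\mu$ to $T_\gamma$. (iii) If $T=\bigoplus_{\gamma\in\Gamma}T_\gamma$ is a countable parallel composition, then for all $z\in\mathbb{C}$ $$P^{<}_\mu(z)-1=\sum_{\gamma\in\Gamma}\big(P^{<}_{\mu|_{T_\gamma}}(z)-1\big),\qquad\text{and when }|z|<R,\quad P^{\le}_\mu(z)-1=\sum_{\gamma\in\Gamma}\big(P^{\le}_{\mu|_{T_\gamma}}(z)-1\big).$$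
   Context: Every partially ordered set $T$ carries a $\sigma$-algebra such that $\{(x,y)\in T^2:x<y\}$ and $\{(x,y)\in T^2:x\le y\}$ are measurable for the product $\sigma$-algebra on $T^2$; measures on $T$ are defined on it, and $\|\mu\|=\mu(T)$. Atoms of $\mu$: $\mathcal{A}=\{x\in T:\mu(\{x\})>0\}$, $m_\alpha=\mu(\{\alpha\})$, $m_d=\mu(T\setminus\mathcal{A})$. $\mu$ is degenerate if some $x\in T$ has $\mu(\{x\})=\mu(T)$, and non-degenerate otherwise. Compositions: let $\Gamma$ be a totally ordered index set and $\{T_\gamma\}_{\gamma\in\Gamma}$ partially ordered sets. The series composition $\bigotimes_{\gamma\in\Gamma}T_\gamma$ and the parallel composition $\bigoplus_{\gamma\in\Gamma}T_\gamma$ both have underlying set $\bigsqcup_{\gamma\in\Gamma}T_\gamma$, and in both the order restricted to each $T_\gamma$ is that of $T_\gamma$. For $t\in T_\gamma$, $\tilde t\in T_{\tilde\gamma}$ with $\gamma\ne\tilde\gamma$: in the series composition $t\le\tilde t$ iff $\gamma<\tilde\gamma$; in the parallel composition $t$ and $\tilde t$ are incomparable. The composition is countable if $\Gamma$ is countable. In a composition each $T_\gamma$ is a measurable subset, with $\sigma$-algebra the trace of the one on the composition. $T$ is countably series-parallel if it can be constructed from total orders using countable series and parallel compositions (i.e. it belongs to the smallest class of partial orders containing all total orders and closed under countable series and parallel compositions). Run functions: for a finite non-negative measure $\mu$ on a partial order $T$, $$P^{<}_\mu(Z)=1+\mu(T)Z+\sum_{n=2}^\infty\mu^n(\{(a_1,\dots,a_n)\in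 T^n:a_1<\dots<a_n\})Z^n,$$ $$P^{\le}_\mu(Z)=1+\mu(T)Z+\sum_{n=2}^\infty\mu^n(\{(a_1,\dots,a_n)\in T^n:a_1\le\dots\le a_n\})Z^n,$$ where $\mu^n$ is the $n$-fold product measure. Products and sums over a countable $\Gamma$ are limits of finite partial products and sums along an arbitrary enumeration of $\Gamma$. *)

theory Defs
  imports "HOL-Analysis.Analysis"
begin

section \<open>Partial orders with a \<open>\<sigma>\<close>-algebra\<close>

text \<open>
  A poset together with its \<open>\<sigma>\<close>-algebra (and a measure on it) is a measure space \<open>M\<close> and a
  relation \<open>r\<close> on \<open>space M\<close>, where \<open>(x, y) \<in> r\<close> means \<open>x \<le> y\<close>. As sets of pairs, \<open>r\<close> is the
  relation \<open>\<le>\<close> and \<open>r - Id\<close> is the relation \<open><\<close>.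
\<close>

definition measurable_poset :: "'a measure \<Rightarrow> 'a rel \<Rightarrow> bool" where
  "measurable_poset M r \<longleftrightarrow>
     partial_order_on (space M) r \<and>
     r - Id \<in> sets (M \<Otimes>\<^sub>M M) \<and>
     r \<in> sets (M \<Otimes>\<^sub>M M)"

definition atoms :: "'a measure \<Rightarrow> 'a set" where
  "atoms M = {x \<in> space M. measure M {x} > 0}"

definition diffuse_mass :: "'a measure \<Rightarrow> real" where
  "diffuse_mass M = measure M (space M - atoms M)"

definition degenerate :: "'a measure \<Rightarrow> bool" where
  "degenerate M \<longleftrightarrow> (\<exists>x\<in>space M. measure M {x} = measure M (space M))"


section \<open>Series and parallel compositions\<close>

text \<open>
  Compositions are described internally: the underlying set is the disjoint union of the subsets
  \<open>S \<gamma>\<close>. The component with index \<open>\<gamma>\<close> is the poset \<open>Restr r (S \<gamma>)\<close> on \<open>restrict_space M (S \<gamma>)\<close>,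
  which carries the trace \<open>\<sigma>\<close>-algebra and the restricted measure. Components may be empty.
\<close>

definition measurable_partition :: "'a measure \<Rightarrow> 'i set \<Rightarrow> ('i \<Rightarrow> 'a set) \<Rightarrow> bool" where
  "measurable_partition M \<Gamma> S \<longleftrightarrow>
     (\<forall>\<gamma>\<in>\<Gamma>. S \<gamma> \<in> sets M) \<and> disjoint_family_on S \<Gamma> \<and> space M = (\<Union>\<gamma>\<in>\<Gamma>. S \<gamma>)"

definition series_composition ::
  "'a measure \<Rightarrow> 'a rel \<Rightarrow> 'i set \<Rightarrow> 'i rel \<Rightarrow> ('i \<Rightarrow> 'a set) \<Rightarrow> bool" where
  "series_composition M r \<Gamma> rI S \<longleftrightarrow>
     measurable_poset M r \<and> linear_order_on \<Gamma> rI \<and> measurable_partition M \<Gamma> S \<and>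
     (\<forall>\<gamma>\<in>\<Gamma>. \<forall>\<gamma>'\<in>\<Gamma>. \<gamma> \<noteq> \<gamma>' \<longrightarrow>
        (\<forall>s\<in>S \<gamma>. \<forall>t\<in>S \<gamma>'. (s, t) \<in> r \<longleftrightarrow> (\<gamma>, \<gamma>') \<in> rI))"

text \<open>The order of the index set plays no role in a parallel composition, so it is left out.\<close>

definition parallel_composition ::
  "'a measure \<Rightarrow> 'a rel \<Rightarrow> 'i set \<Rightarrow> ('i \<Rightarrow> 'a set) \<Rightarrow> bool" where
  "parallel_composition M r \<Gamma> S \<longleftrightarrow>
     measurable_poset M r \<and> measurable_partition M \<Gamma> S \<and>
     (\<forall>\<gamma>\<in>\<Gamma>. \<forall>\<gamma>'\<in>\<Gamma>. \<gamma> \<noteq> \<gamma>' \<longrightarrow>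
        (\<forall>s\<in>S \<gamma>. \<forall>t\<in>S \<gamma>'. (s, t) \<notin> r \<and> (t, s) \<notin> r))"

text \<open>
  Only \<open>space M\<close> and \<open>sets M\<close> matter here, not the measure. Every countable index set can be
  renamed to a set of natural numbers, with an arbitrary total order \<open>rI\<close> on it.
\<close>

inductive countably_series_parallel :: "'a measure \<Rightarrow> 'a rel \<Rightarrow> bool" where
  total_order:
    "measurable_poset M r \<Longrightarrow> linear_order_on (space M) r \<Longrightarrow> countably_series_parallel M r"
| series:
    "series_composition M r (\<Gamma> :: nat set) rI S \<Longrightarrow>
     \<forall>\<gamma>\<in>\<Gamma>. countably_series_parallel (restrict_space M (S \<gamma>)) (Restr r (S \<gamma>)) \<Longrightarrow>
     countably_series_parallel M r"
| parallel:
    "parallel_composition M r (\<Gamma> :: nat set) S \<Longrightarrow>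
     \<forall>\<gamma>\<in>\<Gamma>. countably_series_parallel (restrict_space M (S \<gamma>)) (Restr r (S \<gamma>)) \<Longrightarrow>
     countably_series_parallel M r"


section \<open>Run functions\<close>

text \<open>
  The \<open>n\<close>-tuple \<open>(a\<^sub>1, \<dots>, a\<^sub>n)\<close> is a function on \<open>{..<n}\<close>, with indices shifted to start at \<open>0\<close>.
\<close>

definition chains :: "'a measure \<Rightarrow> 'a rel \<Rightarrow> nat \<Rightarrow> (nat \<Rightarrow> 'a) set" where
  "chains M R n =
     {a \<in> space (Pi\<^sub>M {..<n} (\<lambda>_. M)). \<forall>i. Suc i < n \<longrightarrow> (a i, a (Suc i)) \<in> R}"

definition run_coeff :: "'a measure \<Rightarrow> 'a rel \<Rightarrow> nat \<Rightarrow> real" where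
  "run_coeff M R n =
     (if n = 0 then 1
      else if n = 1 then measure M (space M)
      else measure (Pi\<^sub>M {..<n} (\<lambda>_. M)) (chains M R n))"

definition run_lt :: "'a measure \<Rightarrow> 'a rel \<Rightarrow> complex fps" where
  "run_lt M r = Abs_fps (\<lambda>n. complex_of_real (run_coeff M (r - Id) n))"

definition run_le :: "'a measure \<Rightarrow> 'a rel \<Rightarrow> complex fps" where
  "run_le M r = Abs_fps (\<lambda>n. complex_of_real (run_coeff M r n))"

text \<open>
  \<open>eval_fps f z\<close> is an unspecified value if the series diverges at \<open>z\<close>, so convergence has to be
  stated alongside.
\<close>

definition converges_at :: "complex fps \<Rightarrow> complex \<Rightarrow> bool" where
  "converges_at f z \<longleftrightarrow> summable (\<lambda>n. fps_nth f n * z ^ n)"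


section \<open>Countable products and sums\<close>

text \<open>
  \<open>l\<close> is the limit of the finite partial products (sums) along every enumeration of \<open>I\<close>. In
  contrast to \<open>has_prod\<close>, the limit of the partial products may be \<open>0\<close>.
\<close>

definition enum_prod :: "('i \<Rightarrow> complex) \<Rightarrow> 'i set \<Rightarrow> complex \<Rightarrow> bool" where
  "enum_prod f I l \<longleftrightarrow>
     countable I \<and>
     (if finite I then (\<Prod>i\<in>I. f i) = l
      else \<forall>e. bij_betw e (UNIV :: nat set) I \<longrightarrow> (\<lambda>n. \<Prod>k<n. f (e k)) \<longlonglongrightarrow> l)"

definition enum_sum :: "('i \<Rightarrow> complex) \<Rightarrow> 'i set \<Rightarrow> complex \<Rightarrow> bool" where
  "enum_sum f I l \<longleftrightarrow>
     countable I \<and>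
     (if finite I then (\<Sum>i\<in>I. f i) = l
      else \<forall>e. bij_betw e (UNIV :: nat set) I \<longrightarrow> (\<lambda>n. \<Sum>k<n. f (e k)) \<longlonglongrightarrow> l)"

end

theory Submission
  imports Defs
begin

text \<open>
  The measure of the chains of length \<open>n\<close> is an iterated integral, and \<open>chain_measure M R S n\<close> is
  the version of it in which all elements of the chain lie in \<open>S\<close>. Splitting a chain in \<open>A \<union> B\<close>, with
  \<open>A\<close> below \<open>B\<close>, at the place where it leaves \<open>A\<close> shows that run functions multiply under finite series
  compositions; they add up (minus \<open>1\<close>) under finite parallel ones. For a countable composition, the
  coefficients of finite subcompositions increase to those of the whole, and the identities pass to
  the limit by Tannery's theorem wherever the series of the whole converges absolutely. For strict
  chains this is everywhere: removing an element \<open>x\<close> from a chain of length \<open>n + 1\<close> leaves a chain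
  in the series composition of \<open>{y. y < x}\<close> and \<open>{y. x < y}\<close>, whence the coefficients are at most
  \<open>\<mu>(T)\<^sup>n / n!\<close>, with equality for a diffuse total order.

  In a total order, adding an atom \<open>\<alpha>\<close> to a set multiplies its run function by that of \<open>{\<alpha>}\<close>. So a
  total order is treated like a composition of its diffuse part and its atoms, although these
  interleave. On the disc of radius \<open>1 / \<mu>(T)\<close> the weak run functions of the diffuse part together
  with finitely many atoms are uniformly bounded, because the masses of the atoms of a non-degenerate
  measure stay away from \<open>\<mu>(T)\<close>.
\<close>

section \<open>Measures of chains as iterated integrals\<close>

text \<open>The mass of the ways to prolong a chain ending at \<open>x\<close> by \<open>n\<close>
  further elements of \<open>S\<close>. The point \<open>x\<close> only restricts the next element
  and need not lie in \<open>S\<close> itself. Values are taken in \<open>ennreal\<close>, so that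
  exchanging integrals needs no integrability.\<close>

primrec chain_from :: "'a measure \<Rightarrow> 'a rel \<Rightarrow> 'a set \<Rightarrow> nat \<Rightarrow> 'a \<Rightarrow> ennreal" where
  "chain_from M R S 0 x = 1"
| "chain_from M R S (Suc n) x = (\<integral>\<^sup>+y. indicator R (x, y) * chain_from M R S n y * indicator S y \<partial>M)"

definition chain_measure :: "'a measure \<Rightarrow> 'a rel \<Rightarrow> 'a set \<Rightarrow> nat \<Rightarrow> ennreal" where
  "chain_measure M R S n =
     (case n of 0 \<Rightarrow> 1 | Suc m \<Rightarrow> \<integral>\<^sup>+x. chain_from M R S m x * indicator S x \<partial>M)"

lemma chain_measure_0 [simp]: "chain_measure M R S 0 = 1"
  by (simp add: chain_measure_def)

lemma chain_measure_Suc: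
  "chain_measure M R S (Suc n) = (\<integral>\<^sup>+x. chain_from M R S n x * indicator S x \<partial>M)"
  by (simp add: chain_measure_def)

lemma chain_from_mono: "S \<subseteq> S' \<Longrightarrow> chain_from M R S n x \<le> chain_from M R S' n x"
proof (induction n arbitrary: x)
  case (Suc n)
  show ?case
    unfolding chain_from.simps
    by (intro nn_integral_mono mult_mono Suc) (use Suc.prems in \<open>auto simp: indicator_def\<close>)
qed simp

lemma chain_measure_mono: "S \<subseteq> S' \<Longrightarrow> chain_measure M R S n \<le> chain_measure M R S' n"
  by (cases n)
     (auto simp: chain_measure_Suc indicator_def intro!: nn_integral_mono mult_mono chain_from_mono)

lemma measurable_indicator_section [measurable]:
  assumes "R \<in> sets (M \<Otimes>\<^sub>M N)"
  shows "(\<lambda>y. indicator R (x, y) :: ennreal) \<in> borel_measurable N"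
proof -
  have "(\<lambda>y. indicator R (x, y) :: ennreal) = indicator (Pair x -` R)"
    by (auto simp: indicator_def)
  then show ?thesis using sets_Pair1[OF assms] by (metis borel_measurable_indicator)
qed

section \<open>Measurability, finiteness and continuity from below\<close>

context finite_measure
begin

lemma measurable_chain_from [measurable]:
  assumes [measurable]: "R \<in> sets (M \<Otimes>\<^sub>M M)" "S \<in> sets M"
  shows "chain_from M R S n \<in> borel_measurable M"
proof (induction n)
  case (Suc n)
  note Suc [measurable]
  show ?case
    unfolding chain_from.simps by measurable
qed simp

lemma chain_from_le: "chain_from M R S n x \<le> emeasure M (space M) ^ n"
proof (induction n arbitrary: x)
  case (Suc n)
  have "chain_from M R S (Suc n) x \<le> (\<integral>\<^sup>+y. emeasure M (space M) ^ n \<partial>M)"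
    unfolding chain_from.simps
    by (intro nn_integral_mono) (use Suc in \<open>auto simp: indicator_def\<close>)
  then show ?case by (simp add: mult.commute)
qed simp

lemma chain_measure_le: "chain_measure M R S n \<le> emeasure M (space M) ^ n"
proof (cases n)
  case (Suc m)
  have "chain_measure M R S n \<le> (\<integral>\<^sup>+y. emeasure M (space M) ^ m \<partial>M)"
    unfolding Suc chain_measure_Suc
    by (intro nn_integral_mono) (use chain_from_le in \<open>auto simp: indicator_def\<close>)
  then show ?thesis by (simp add: Suc mult.commute)
qed simp

lemma chain_measure_finite: "chain_measure M R S n < top"
  by (rule order_le_less_trans[OF chain_measure_le])
     (simp add: less_top[symmetric] power_eq_top_ennreal)

lemma chain_from_finite: "chain_from M R S n x < top"
  by (rule order_le_less_trans[OF chain_from_le])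
     (simp add: less_top[symmetric] power_eq_top_ennreal)

text \<open>Monotone convergence in each of the nested integrals. The finiteness from
  \<open>chain_from_finite\<close> enters because multiplication on \<open>ennreal\<close> is
  discontinuous at 0 times infinity.\<close>

lemma chain_from_LIMSEQ:
  assumes R [measurable]: "R \<in> sets (M \<Otimes>\<^sub>M M)" and S [measurable]: "\<And>k. S k \<in> sets M"
    and inc: "incseq S"
  shows "(\<lambda>k. chain_from M R (S k) n x) \<longlonglongrightarrow> chain_from M R (\<Union>k. S k) n x"
proof (induction n arbitrary: x)
  case (Suc n)
  have "(\<lambda>k. indicator R (x, y) * chain_from M R (S k) n y * indicator (S k) y)
          \<longlonglongrightarrow> indicator R (x, y) * chain_from M R (\<Union>k. S k) n y * indicator (\<Union>k. S k) y" for y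
    by (intro tendsto_mult_ennreal tendsto_const Suc LIMSEQ_indicator_incseq inc)
       (use chain_from_finite in \<open>auto simp: indicator_def less_top\<close>)
  moreover have "incseq (\<lambda>k y. indicator R (x, y) * chain_from M R (S k) n y * indicator (S k) y :: ennreal)"
    using inc by (auto simp: incseq_def le_fun_def indicator_def intro!: mult_mono chain_from_mono)
  ultimately show ?case
    unfolding chain_from.simps by (intro nn_integral_LIMSEQ) measurable
qed simp


lemma chain_measure_LIMSEQ:
  assumes R [measurable]: "R \<in> sets (M \<Otimes>\<^sub>M M)" and S [measurable]: "\<And>k. S k \<in> sets M"
    and inc: "incseq S"
  shows "(\<lambda>k. chain_measure M R (S k) n) \<longlonglongrightarrow> chain_measure M R (\<Union>k. S k) n"
proof (cases n)
  case (Suc m)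
  have "(\<lambda>k. chain_from M R (S k) m y * indicator (S k) y)
          \<longlonglongrightarrow> chain_from M R (\<Union>k. S k) m y * indicator (\<Union>k. S k) y" for y
    by (intro tendsto_mult_ennreal chain_from_LIMSEQ assms LIMSEQ_indicator_incseq)
       (use chain_from_finite in \<open>auto simp: indicator_def less_top\<close>)
  moreover have "incseq (\<lambda>k y. chain_from M R (S k) m y * indicator (S k) y :: ennreal)"
    using inc by (auto simp: incseq_def le_fun_def indicator_def intro!: mult_mono chain_from_mono)
  ultimately show ?thesis
    unfolding chain_measure_Suc Suc by (intro nn_integral_LIMSEQ) measurable
qed simp

section \<open>Chains in a union of two sets\<close>

text \<open>A chain that has reached \<open>B\<close> can never step back into
  \<open>A\<close>.\<close>

lemma chain_from_Un_upper:
  assumes "\<And>a b. a \<in> A \<Longrightarrow> b \<in> B \<Longrightarrow> (b, a) \<notin> R" and "x \<in> B"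
  shows "chain_from M R (A \<union> B) n x = chain_from M R B n x"
  using assms(2)
proof (induction n arbitrary: x)
  case (Suc n)
  then show ?case
    unfolding chain_from.simps by (intro nn_integral_cong) (use assms(1) in \<open>auto simp: indicator_def\<close>)
qed simp

text \<open>The index \<open>k\<close> counts the further elements in \<open>A\<close> before the
  chain leaves \<open>A\<close> for good. Since all of \<open>B\<close> is above all of
  \<open>A\<close>, the remaining \<open>n - k\<close> elements form an arbitrary chain in
  \<open>B\<close>, whence the factor independent of \<open>x\<close>.\<close>

lemma chain_from_Un_series:
  assumes [measurable]: "R \<in> sets (M \<Otimes>\<^sub>M M)" "A \<in> sets M" "B \<in> sets M"
    and disj: "A \<inter> B = {}"
    and up: "\<And>a b. a \<in> A \<Longrightarrow> b \<in> B \<Longrightarrow> (a, b) \<in> R"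
    and down: "\<And>a b. a \<in> A \<Longrightarrow> b \<in> B \<Longrightarrow> (b, a) \<notin> R"
    and "x \<in> A"
  shows "chain_from M R (A \<union> B) n x = (\<Sum>k\<le>n. chain_from M R A k x * chain_measure M R B (n - k))"
  using \<open>x \<in> A\<close>
proof (induction n arbitrary: x)
  case (Suc n)
  \<comment> \<open>The next element \<open>y\<close> lies in \<open>A\<close> or in
    \<open>B\<close>. In \<open>A\<close> the induction hypothesis applies; in \<open>B\<close> the
    comparison with \<open>x\<close> is automatic and the chain stays in \<open>B\<close>.\<close>
  have "chain_from M R (A \<union> B) (Suc n) x =
      (\<integral>\<^sup>+y. (\<Sum>k\<le>n. indicator R (x, y) * chain_from M R A k y * indicator A y * chain_measure M R B (n - k))
            + chain_from M R B n y * indicator B y \<partial>M)"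
    unfolding chain_from.simps
  proof (intro nn_integral_cong)
    fix y
    show "indicator R (x, y) * chain_from M R (A \<union> B) n y * indicator (A \<union> B) y =
      (\<Sum>k\<le>n. indicator R (x, y) * chain_from M R A k y * indicator A y * chain_measure M R B (n - k))
            + chain_from M R B n y * indicator B y"
    proof (cases "y \<in> A")
      case True
      then show ?thesis using disj Suc.IH[OF True] by (auto simp: indicator_def)
    next
      case False
      then show ?thesis
        using up[OF Suc.prems] chain_from_Un_upper[of A B R y n, OF down]
        by (auto simp: indicator_def)
    qed
  qed
  also have "\<dots> = (\<Sum>k\<le>n. chain_from M R A (Suc k) x * chain_measure M R B (n - k))
      + chain_measure M R B (Suc n)"
    by (simp add: nn_integral_add nn_integral_sum nn_integral_multc chain_measure_Suc)
  \<comment> \<open>The isolated term becomes the summand \<open>k = 0\<close>, where no further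
    element lies in \<open>A\<close>.\<close>
  also have "\<dots> = (\<Sum>k\<le>Suc n. chain_from M R A k x * chain_measure M R B (Suc n - k))"
    by (subst sum.atMost_Suc_shift) (simp add: add.commute)
  finally show ?case .
qed simp

text \<open>The split of \<open>chain_from_Un_series\<close> with the first element integrated as
  well; the summand \<open>k = 0\<close> now collects the chains that lie entirely in
  \<open>B\<close>.\<close>

lemma chain_measure_Un_series:
  assumes [measurable]: "R \<in> sets (M \<Otimes>\<^sub>M M)" "A \<in> sets M" "B \<in> sets M"
    and disj: "A \<inter> B = {}"
    and up: "\<And>a b. a \<in> A \<Longrightarrow> b \<in> B \<Longrightarrow> (a, b) \<in> R"
    and down: "\<And>a b. a \<in> A \<Longrightarrow> b \<in> B \<Longrightarrow> (b, a) \<notin> R"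
  shows "chain_measure M R (A \<union> B) n = (\<Sum>k\<le>n. chain_measure M R A k * chain_measure M R B (n - k))"
proof (cases n)
  case (Suc m)
  have "chain_measure M R (A \<union> B) (Suc m) =
      (\<integral>\<^sup>+y. (\<Sum>k\<le>m. chain_from M R A k y * indicator A y * chain_measure M R B (m - k))
            + chain_from M R B m y * indicator B y \<partial>M)"
    unfolding chain_measure_Suc
  proof (intro nn_integral_cong)
    fix y
    show "chain_from M R (A \<union> B) m y * indicator (A \<union> B) y =
      (\<Sum>k\<le>m. chain_from M R A k y * indicator A y * chain_measure M R B (m - k))
            + chain_from M R B m y * indicator B y"
    proof (cases "y \<in> A")
      case True
      then show ?thesis using disj chain_from_Un_series[OF assms True] by (auto simp: indicator_def)
    next
      case False
      then show ?thesis
        using chain_from_Un_upper[of A B R y m, OF down] by (auto simp: indicator_def)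
    qed
  qed
  also have "\<dots> = (\<Sum>k\<le>m. chain_measure M R A (Suc k) * chain_measure M R B (m - k))
      + chain_measure M R B (Suc m)"
    by (simp add: nn_integral_add nn_integral_sum nn_integral_multc chain_measure_Suc)
  also have "\<dots> = (\<Sum>k\<le>Suc m. chain_measure M R A k * chain_measure M R B (Suc m - k))"
    by (subst sum.atMost_Suc_shift) (simp add: add.commute)
  finally show ?thesis unfolding Suc .
qed simp

text \<open>The first element decides in which of the two sets the whole chain lies. Length 0 is
  excluded because the right-hand side would count the empty chain twice.\<close>

lemma chain_measure_Un_parallel:
  assumes [measurable]: "R \<in> sets (M \<Otimes>\<^sub>M M)" "A \<in> sets M" "B \<in> sets M"
    and disj: "A \<inter> B = {}"
    and incomparable: "\<And>a b. a \<in> A \<Longrightarrow> b \<in> B \<Longrightarrow> (a, b) \<notin> R \<and> (b, a) \<notin> R"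
  shows "chain_measure M R (A \<union> B) (Suc n) = chain_measure M R A (Suc n) + chain_measure M R B (Suc n)"
proof -
  have "chain_measure M R (A \<union> B) (Suc n) =
      (\<integral>\<^sup>+y. chain_from M R A n y * indicator A y + chain_from M R B n y * indicator B y \<partial>M)"
    unfolding chain_measure_Suc
  proof (intro nn_integral_cong)
    fix y
    show "chain_from M R (A \<union> B) n y * indicator (A \<union> B) y =
      chain_from M R A n y * indicator A y + chain_from M R B n y * indicator B y"
      using disj incomparable chain_from_Un_upper[of A B R y n] chain_from_Un_upper[of B A R y n]
      by (cases "y \<in> A"; cases "y \<in> B") (auto simp: indicator_def Un_commute)
  qed
  then show ?thesis by (simp add: nn_integral_add chain_measure_Suc)
qed

end

section \<open>Measurability of sections and of sets of chains\<close>

lemma sets_converse [measurable]: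
  assumes "R \<in> sets (M \<Otimes>\<^sub>M N)"
  shows "R\<inverse> \<in> sets (N \<Otimes>\<^sub>M M)"
proof -
  have "R\<inverse> = (\<lambda>(x, y). (y, x)) -` R \<inter> space (N \<Otimes>\<^sub>M M)"
    using sets.sets_into_space[OF assms] by (auto simp: space_pair_measure)
  then show ?thesis using sets_pair_swap[OF assms] by simp
qed

lemma sets_successors [measurable]:
  assumes "R \<in> sets (M \<Otimes>\<^sub>M M)" "S \<in> sets M"
  shows "{y \<in> S. (x, y) \<in> R} \<in> sets M"
proof -
  have "{y \<in> S. (x, y) \<in> R} = S \<inter> Pair x -` R" by auto
  then show ?thesis using sets_Pair1[OF assms(1)] assms(2) by auto
qed

lemma sets_predecessors [measurable]:
  assumes "R \<in> sets (M \<Otimes>\<^sub>M M)" "S \<in> sets M"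
  shows "{y \<in> S. (y, x) \<in> R} \<in> sets M"
  using sets_successors[OF sets_converse[OF assms(1)] assms(2)] by simp

lemma measurable_chains:
  assumes R: "R \<in> sets (M \<Otimes>\<^sub>M M)"
  shows "chains M R n \<in> sets (Pi\<^sub>M {..<n} (\<lambda>_. M))"
proof -
  let ?P = "Pi\<^sub>M {..<n} (\<lambda>_. M)"
  have 1: "{a \<in> space ?P. (a i, a (Suc i)) \<in> R} \<in> sets ?P" if "i \<in> {..<n - 1}" for i
  proof -
    have "(\<lambda>a. (a i, a (Suc i))) \<in> ?P \<rightarrow>\<^sub>M M \<Otimes>\<^sub>M M"
      using that by (intro measurable_Pair measurable_component_singleton) auto
    from measurable_sets[OF this R]
    have "(\<lambda>a. (a i, a (Suc i))) -` R \<inter> space ?P \<in> sets ?P" .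
    moreover have "{a \<in> space ?P. (a i, a (Suc i)) \<in> R} = (\<lambda>a. (a i, a (Suc i))) -` R \<inter> space ?P"
      by auto
    ultimately show ?thesis by (simp only:)
  qed
  have "{a \<in> space ?P. \<forall>i\<in>{..<n - 1}. (a i, a (Suc i)) \<in> R} \<in> sets ?P"
    by (rule sets.sets_Collect_finite_All[OF 1]) simp_all
  \<comment> \<open>Truncated subtraction makes the index set empty for \<open>n = 0\<close> as well
    as for \<open>n = 1\<close>.\<close>
  moreover have "chains M R n = {a \<in> space ?P. \<forall>i\<in>{..<n - 1}. (a i, a (Suc i)) \<in> R}"
    by (auto simp: chains_def less_diff_conv)
  ultimately show ?thesis by (simp only:)
qed

text \<open>The product measure is integrated one coordinate at a time, the last one first.
  Appending \<open>y\<close> adds only the comparison with the former last element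
  \<open>a n\<close>.\<close>

lemma chains_Suc_iff:
  assumes "a \<in> space (Pi\<^sub>M {..<Suc n} (\<lambda>_. M))" "y \<in> space M"
  shows "a(Suc n := y) \<in> chains M R (Suc (Suc n)) \<longleftrightarrow> a \<in> chains M R (Suc n) \<and> (a n, y) \<in> R"
proof -
  have "a(Suc n := y) \<in> space (Pi\<^sub>M {..<Suc (Suc n)} (\<lambda>_. M))"
    unfolding lessThan_Suc[of "Suc n"] using assms
    by (intro PiE_fun_upd[of y "\<lambda>_. space M", folded space_PiM]) auto
  moreover have "(\<forall>i. Suc i < Suc (Suc n) \<longrightarrow> ((a(Suc n := y)) i, (a(Suc n := y)) (Suc i)) \<in> R)
      \<longleftrightarrow> (\<forall>i. Suc i < Suc n \<longrightarrow> (a i, a (Suc i)) \<in> R) \<and> (a n, y) \<in> R"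
    by (auto simp: All_less_Suc)
  ultimately show ?thesis using assms unfolding chains_def mem_Collect_eq by blast
qed

section \<open>Reversal of chains and the factorial bound\<close>

context finite_measure
begin

lemma nn_integral_swap:
  "case_prod f \<in> borel_measurable (M \<Otimes>\<^sub>M M) \<Longrightarrow>
    (\<integral>\<^sup>+y. (\<integral>\<^sup>+x. f x y \<partial>M) \<partial>M) = (\<integral>\<^sup>+x. (\<integral>\<^sup>+y. f x y \<partial>M) \<partial>M)"
  using pair_sigma_finite.Fubini'[of M M f] sigma_finite_measure_axioms
  by (simp add: pair_sigma_finite_def)

text \<open>Chains of length \<open>i + j + 1\<close> seen from a pivot \<open>x\<close> that has
  \<open>i\<close> elements before it and \<open>j\<close> after it. The value does not depend on
  the position of the pivot, and the induction moves the pivot one place down.\<close>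

lemma nn_integral_chain_from_converse:
  assumes [measurable]: "R \<in> sets (M \<Otimes>\<^sub>M M)" "S \<in> sets M"
  shows "(\<integral>\<^sup>+x. chain_from M (R\<inverse>) S i x * chain_from M R S j x * indicator S x \<partial>M)
      = chain_measure M R S (Suc (i + j))"
proof (induction i arbitrary: j)
  case (Suc i)
  have "(\<integral>\<^sup>+x. chain_from M (R\<inverse>) S (Suc i) x * chain_from M R S j x * indicator S x \<partial>M)
      = (\<integral>\<^sup>+x. (\<integral>\<^sup>+y. indicator (R\<inverse>) (x, y) * chain_from M (R\<inverse>) S i y * indicator S y
            * (chain_from M R S j x * indicator S x) \<partial>M) \<partial>M)"
    by (subst nn_integral_multc, measurable) (simp add: mult.assoc)
  \<comment> \<open>Tonelli makes the immediate predecessor \<open>y\<close> of \<open>x\<close> the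
    new pivot; \<open>x\<close> becomes the first of the \<open>j + 1\<close> elements after
    it.\<close>
  also have "\<dots> = (\<integral>\<^sup>+y. (\<integral>\<^sup>+x. indicator (R\<inverse>) (x, y) * chain_from M (R\<inverse>) S i y * indicator S y
            * (chain_from M R S j x * indicator S x) \<partial>M) \<partial>M)"
    by (rule nn_integral_swap[symmetric]) measurable
  also have "\<dots> = (\<integral>\<^sup>+y. (\<integral>\<^sup>+x. (indicator R (y, x) * chain_from M R S j x * indicator S x)
            * (chain_from M (R\<inverse>) S i y * indicator S y) \<partial>M) \<partial>M)"
    by (intro nn_integral_cong) (auto simp: indicator_def mult.commute)
  also have "\<dots> = (\<integral>\<^sup>+y. chain_from M (R\<inverse>) S i y * chain_from M R S (Suc j) y * indicator S y \<partial>M)"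
    by (subst nn_integral_multc, measurable) (simp add: mult_ac)
  also have "\<dots> = chain_measure M R S (Suc (Suc i + j))"
    using Suc.IH[of "Suc j"] by simp
  finally show ?case .
qed (simp add: chain_measure_Suc)

text \<open>With the last element as pivot, that is \<open>j = 0\<close>, the chain is read
  backwards.\<close>

lemma chain_measure_converse:
  assumes "R \<in> sets (M \<Otimes>\<^sub>M M)" "S \<in> sets M"
  shows "chain_measure M (R\<inverse>) S n = chain_measure M R S n"
  using nn_integral_chain_from_converse[OF assms, of _ 0]
  by (cases n) (auto simp: chain_measure_Suc)

text \<open>By transitivity a chain lies entirely above \<open>x\<close> as soon as its first
  element does, so only the first step has to be compared with \<open>x\<close>.\<close>

lemma chain_measure_successors:
  assumes "trans R"
  shows "chain_measure M R {y \<in> S. (x, y) \<in> R} n = chain_from M R S n x"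
proof (cases n)
  case (Suc m)
  have *: "chain_from M R {y \<in> S. (x, y) \<in> R} k y = chain_from M R S k y" if "(x, y) \<in> R" for k y
    using that
  proof (induction k arbitrary: y)
    case (Suc k)
    then show ?case unfolding chain_from.simps
      by (intro nn_integral_cong) (auto simp: indicator_def dest: transD[OF assms])
  qed simp
  show ?thesis unfolding Suc chain_measure_Suc chain_from.simps
    by (intro nn_integral_cong) (auto simp: indicator_def *)
qed simp

lemma chain_measure_predecessors:
  assumes "trans R" "R \<in> sets (M \<Otimes>\<^sub>M M)" "S \<in> sets M"
  shows "chain_measure M R {y \<in> S. (y, x) \<in> R} n = chain_from M (R\<inverse>) S n x"
proof -
  have "chain_measure M R {y \<in> S. (y, x) \<in> R} n = chain_measure M (R\<inverse>) {y \<in> S. (x, y) \<in> R\<inverse>} n"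
    using assms by (subst chain_measure_converse) auto
  also have "\<dots> = chain_from M (R\<inverse>) S n x"
    using assms by (intro chain_measure_successors) auto
  finally show ?thesis .
qed

text \<open>Each chain of length \<open>n + 1\<close> is counted once for each of its elements \<open>x\<close>.\<close>

lemma Suc_times_chain_measure:
  assumes [measurable]: "R \<in> sets (M \<Otimes>\<^sub>M M)" "S \<in> sets M" and "trans R" "irrefl R"
  shows "of_nat (Suc n) * chain_measure M R S (Suc n) =
    (\<integral>\<^sup>+x. chain_measure M R ({y \<in> S. (y, x) \<in> R} \<union> {y \<in> S. (x, y) \<in> R}) n * indicator S x \<partial>M)"
proof -
  \<comment> \<open>Transitivity puts each predecessor of \<open>x\<close> below each successor, and
    a relation in the other direction would violate irreflexivity. So the union is a series
    composition.\<close>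
  have "chain_measure M R ({y \<in> S. (y, x) \<in> R} \<union> {y \<in> S. (x, y) \<in> R}) n =
      (\<Sum>i\<le>n. chain_from M (R\<inverse>) S i x * chain_from M R S (n - i) x)" for x
    using assms
    by (subst chain_measure_Un_series)
       (auto simp: chain_measure_successors chain_measure_predecessors irrefl_def dest: transD)
  then have "(\<integral>\<^sup>+x. chain_measure M R ({y \<in> S. (y, x) \<in> R} \<union> {y \<in> S. (x, y) \<in> R}) n * indicator S x \<partial>M)
     = (\<integral>\<^sup>+x. (\<Sum>i\<le>n. chain_from M (R\<inverse>) S i x * chain_from M R S (n - i) x * indicator S x) \<partial>M)"
    by (simp add: sum_distrib_right)
  \<comment> \<open>All pivot positions contribute the same amount, and there are
    \<open>n + 1\<close> of them.\<close>
  also have "\<dots> = (\<Sum>i\<le>n. chain_measure M R S (Suc n))"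
    by (subst nn_integral_sum) (auto simp: nn_integral_chain_from_converse)
  finally show ?thesis by simp
qed

text \<open>The chain that remains after the removal of \<open>x\<close> is counted in the larger
  set \<open>S\<close>; this gives a recursion solved by the factorial. The factorial stays on the
  left to avoid division in \<open>ennreal\<close>.\<close>

lemma fact_times_chain_measure_le:
  assumes [measurable]: "R \<in> sets (M \<Otimes>\<^sub>M M)" "S \<in> sets M" and "trans R" "irrefl R"
  shows "fact n * chain_measure M R S n \<le> emeasure M S ^ n"
proof (induction n)
  case (Suc n)
  have "of_nat (Suc n) * chain_measure M R S (Suc n) \<le> (\<integral>\<^sup>+x. chain_measure M R S n * indicator S x \<partial>M)"
    unfolding Suc_times_chain_measure[OF assms]
    by (intro nn_integral_mono mult_right_mono chain_measure_mono) auto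
  also have "\<dots> = chain_measure M R S n * emeasure M S"
    by (simp add: nn_integral_cmult_indicator)
  finally have "fact n * (of_nat (Suc n) * chain_measure M R S (Suc n))
      \<le> fact n * (chain_measure M R S n * emeasure M S)"
    by (intro mult_left_mono) auto
  also have "\<dots> \<le> emeasure M S ^ n * emeasure M S"
    using mult_right_mono[OF Suc, of "emeasure M S"] by (simp add: mult.assoc)
  finally show ?case
    unfolding fact_Suc power_Suc by (simp add: mult_ac)
qed simp

section \<open>Null sets, diffuse sets and single points\<close>

lemma chain_measure_Diff_null:
  assumes "N \<in> null_sets M"
  shows "chain_measure M R (S - N) n = chain_measure M R S n"
proof -
  have AE: "AE x in M. x \<notin> N" by (rule AE_not_in[OF assms])
  have *: "chain_from M R (S - N) k x = chain_from M R S k x" for k x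
  proof (induction k arbitrary: x)
    case (Suc k)
    show ?case unfolding chain_from.simps Suc
      using AE by (intro nn_integral_cong_AE) (auto simp: indicator_def elim: eventually_mono)
  qed simp
  show ?thesis
    unfolding chain_measure_def *
    using AE by (auto simp: indicator_def elim: eventually_mono split: nat.split intro!: nn_integral_cong_AE)
qed

text \<open>The recursion of \<open>fact_times_chain_measure_le\<close> becomes an equality: by
  totality, predecessors and successors of \<open>x\<close> fill \<open>S\<close> up to the point
  \<open>x\<close>, which is null.\<close>

lemma fact_times_chain_measure_diffuse:
  assumes [measurable]: "R \<in> sets (M \<Otimes>\<^sub>M M)" "S \<in> sets M" and "trans R" "irrefl R"
    and total: "total_on S R" and null: "\<And>x. x \<in> S \<Longrightarrow> {x} \<in> null_sets M"
  shows "fact n * chain_measure M R S n = emeasure M S ^ n"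
proof (induction n)
  case (Suc n)
  have "{y \<in> S. (y, x) \<in> R} \<union> {y \<in> S. (x, y) \<in> R} = S - {x}" if "x \<in> S" for x
    using that total \<open>irrefl R\<close> by (auto simp: total_on_def irrefl_def)
  then have "of_nat (Suc n) * chain_measure M R S (Suc n) = (\<integral>\<^sup>+x. chain_measure M R S n * indicator S x \<partial>M)"
    unfolding Suc_times_chain_measure[OF assms(1-4)]
    by (intro nn_integral_cong) (auto simp: indicator_def chain_measure_Diff_null[OF null])
  also have "\<dots> = chain_measure M R S n * emeasure M S"
    by (simp add: nn_integral_cmult_indicator)
  finally have "of_nat (Suc n) * chain_measure M R S (Suc n) = chain_measure M R S n * emeasure M S" .
  then have "fact (Suc n) * chain_measure M R S (Suc n) = fact n * chain_measure M R S n * emeasure M S"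
    unfolding fact_Suc by (simp add: mult_ac)
  then show ?case using Suc by (simp add: mult.commute)
qed simp

text \<open>Repeating the previous element confines the next one to a null set, so weak and strict
  chains have the same measure.\<close>

lemma chain_measure_diff_Id_diffuse:
  assumes null: "\<And>x. x \<in> S \<Longrightarrow> {x} \<in> null_sets M"
  shows "chain_measure M (R - Id) S n = chain_measure M R S n"
proof -
  have *: "chain_from M (R - Id) S k x = chain_from M R S k x" for k x
  proof (induction k arbitrary: x)
    case (Suc k)
    \<comment> \<open>Points outside \<open>S\<close> are not assumed to be null, but after such a
      point no element of \<open>S\<close> can be a repetition.\<close>
    show ?case
    proof (cases "x \<in> S")
      case True
      then have "AE y in M. y \<notin> {x}" using AE_not_in null by blast
      then show ?thesis unfolding chain_from.simps Suc
        by (intro nn_integral_cong_AE) (auto simp: indicator_def elim: eventually_mono)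
    next
      case False
      then show ?thesis unfolding chain_from.simps Suc
        by (intro nn_integral_cong) (auto simp: indicator_def)
    qed
  qed simp
  show ?thesis unfolding chain_measure_def * ..
qed

lemma chain_measure_singleton:
  assumes [measurable]: "{x} \<in> sets M" and "(x, x) \<in> R"
  shows "chain_measure M R {x} n = emeasure M {x} ^ n"
proof -
  have "chain_from M R {x} k x = emeasure M {x} ^ k" for k
  proof (induction k)
    case (Suc k)
    have "chain_from M R {x} (Suc k) x = (\<integral>\<^sup>+y. emeasure M {x} ^ k * indicator {x} y \<partial>M)"
      unfolding chain_from.simps
      by (intro nn_integral_cong) (use Suc assms in \<open>auto simp: indicator_def\<close>)
    also have "\<dots> = emeasure M {x} ^ Suc k"
      using assms(1) by (subst nn_integral_cmult_indicator) (auto simp: mult.commute)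
    finally show ?case .
  qed simp
  note * = this
  show ?thesis
  proof (cases n)
    case (Suc k)
    have "chain_measure M R {x} (Suc k) = (\<integral>\<^sup>+y. emeasure M {x} ^ k * indicator {x} y \<partial>M)"
      unfolding chain_measure_Suc by (intro nn_integral_cong) (auto simp: indicator_def *)
    then show ?thesis
      unfolding Suc nn_integral_cmult_indicator[OF assms(1)] by (simp add: mult.commute)
  qed simp
qed

lemma chain_measure_singleton_irrefl:
  assumes [measurable]: "{x} \<in> sets M" and "(x, x) \<notin> R"
  shows "chain_measure M R {x} n = (if n = 0 then 1 else if n = 1 then emeasure M {x} else 0)"
proof (cases n)
  case (Suc k)
  have *: "chain_from M R {x} (Suc j) x = 0" for j
  proof -
    have "chain_from M R {x} (Suc j) x = (\<integral>\<^sup>+y. 0 \<partial>M)"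
      unfolding chain_from.simps using assms by (intro nn_integral_cong) (auto simp: indicator_def)
    then show ?thesis by simp
  qed
  have "chain_measure M R {x} (Suc k) = (\<integral>\<^sup>+y. chain_from M R {x} k x * indicator {x} y \<partial>M)"
    unfolding chain_measure_Suc by (intro nn_integral_cong) (auto simp: indicator_def)
  then have "chain_measure M R {x} (Suc k) = chain_from M R {x} k x * emeasure M {x}"
    unfolding nn_integral_cmult_indicator[OF assms(1)] .
  then show ?thesis unfolding Suc by (cases k) (simp_all only: *, simp_all)
qed simp

section \<open>From the product measure to iterated integrals\<close>

text \<open>The weight \<open>f\<close> on the last element makes the induction work: integrating
  out the newest coordinate produces a new weight on the previous one. The converse of
  \<open>R\<close> appears because the chain is read from its last element downwards.\<close>

lemma nn_integral_chains:
  assumes R [measurable]: "R \<in> sets (M \<Otimes>\<^sub>M M)" and f [measurable]: "f \<in> borel_measurable M"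
  shows "(\<integral>\<^sup>+a. indicator (chains M R (Suc n)) a * f (a n) \<partial>Pi\<^sub>M {..<Suc n} (\<lambda>_. M))
    = (\<integral>\<^sup>+x. chain_from M (R\<inverse>) (space M) n x * f x \<partial>M)"
  using f
proof (induction n arbitrary: f)
  case 0
  interpret product_sigma_finite "\<lambda>_. M" ..
  have "(\<integral>\<^sup>+a. indicator (chains M R (Suc 0)) a * f (a 0) \<partial>Pi\<^sub>M {..<Suc 0} (\<lambda>_. M))
     = (\<integral>\<^sup>+a. f (a 0) \<partial>Pi\<^sub>M {0::nat} (\<lambda>_. M))"
    unfolding lessThan_Suc lessThan_0
    by (intro nn_integral_cong) (auto simp: chains_def indicator_def lessThan_Suc)
  then show ?case using product_nn_integral_singleton[of f "0::nat"] 0 by simp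
next
  case (Suc n)
  interpret product_sigma_finite "\<lambda>_. M" ..
  note Suc.prems [measurable] measurable_chains[OF R, measurable]
  let ?P = "\<lambda>n. Pi\<^sub>M {..<n} (\<lambda>_. M)"
  have eq: "{..<Suc (Suc n)} = insert (Suc n) {..<Suc n}" by auto
  have comp [measurable]: "(\<lambda>a. a (Suc n)) \<in> ?P (Suc (Suc n)) \<rightarrow>\<^sub>M M"
    by (intro measurable_component_singleton) simp
  have "(\<lambda>a. indicator (chains M R (Suc (Suc n))) a * f (a (Suc n))) \<in> borel_measurable (?P (Suc (Suc n)))"
    by measurable
  then have "(\<integral>\<^sup>+a. indicator (chains M R (Suc (Suc n))) a * f (a (Suc n)) \<partial>?P (Suc (Suc n)))
     = (\<integral>\<^sup>+a. (\<integral>\<^sup>+y. indicator (chains M R (Suc (Suc n))) (a(Suc n := y))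
          * f ((a(Suc n := y)) (Suc n)) \<partial>M) \<partial>?P (Suc n))"
    unfolding eq by (intro product_nn_integral_insert) simp_all
  also have "\<dots> = (\<integral>\<^sup>+a. indicator (chains M R (Suc n)) a
      * (\<integral>\<^sup>+y. indicator R (a n, y) * f y \<partial>M) \<partial>?P (Suc n))"
    by (intro nn_integral_cong, subst nn_integral_cmult[symmetric], measurable, intro nn_integral_cong)
       (auto simp: indicator_def chains_Suc_iff)
  also have "\<dots> = (\<integral>\<^sup>+x. chain_from M (R\<inverse>) (space M) n x * (\<integral>\<^sup>+y. indicator R (x, y) * f y \<partial>M) \<partial>M)"
    by (rule Suc.IH) measurable
  also have "\<dots> = (\<integral>\<^sup>+x. (\<integral>\<^sup>+y. chain_from M (R\<inverse>) (space M) n x * (indicator R (x, y) * f y) \<partial>M) \<partial>M)"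
    by (intro nn_integral_cong nn_integral_cmult[symmetric]) measurable
  \<comment> \<open>Tonelli makes the last element \<open>y\<close> the outer variable, and
    \<open>x\<close> becomes the first step down from \<open>y\<close> in the recursion for the
    converse.\<close>
  also have "\<dots> = (\<integral>\<^sup>+y. (\<integral>\<^sup>+x. chain_from M (R\<inverse>) (space M) n x * (indicator R (x, y) * f y) \<partial>M) \<partial>M)"
    by (rule nn_integral_swap[symmetric]) measurable
  also have "\<dots> = (\<integral>\<^sup>+y. (\<integral>\<^sup>+x. indicator (R\<inverse>) (y, x) * chain_from M (R\<inverse>) (space M) n x
      * indicator (space M) x * f y \<partial>M) \<partial>M)"
    by (intro nn_integral_cong) (auto simp: indicator_def)
  also have "\<dots> = (\<integral>\<^sup>+y. chain_from M (R\<inverse>) (space M) (Suc n) y * f y \<partial>M)"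
    unfolding chain_from.simps by (intro nn_integral_cong nn_integral_multc) measurable
  finally show ?case .
qed

text \<open>With weight 1, \<open>nn_integral_chains\<close> measures chains from the top, and
  \<open>chain_measure_converse\<close> turns them round.\<close>

lemma run_coeff_eq_chain_measure:
  assumes R [measurable]: "R \<in> sets (M \<Otimes>\<^sub>M M)"
  shows "run_coeff M R n = enn2real (chain_measure M R (space M) n)"
proof -
  have "emeasure (Pi\<^sub>M {..<Suc m} (\<lambda>_. M)) (chains M R (Suc m)) = chain_measure M R (space M) (Suc m)" for m
  proof -
    have "emeasure (Pi\<^sub>M {..<Suc m} (\<lambda>_. M)) (chains M R (Suc m)) =
       (\<integral>\<^sup>+a. indicator (chains M R (Suc m)) a * 1 \<partial>Pi\<^sub>M {..<Suc m} (\<lambda>_. M))"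
      unfolding mult_1_right by (rule nn_integral_indicator[symmetric]) (rule measurable_chains[OF R])
    also have "\<dots> = (\<integral>\<^sup>+x. chain_from M (R\<inverse>) (space M) m x * 1 \<partial>M)"
      by (rule nn_integral_chains) measurable
    also have "\<dots> = chain_measure M (R\<inverse>) (space M) (Suc m)"
      unfolding chain_measure_Suc by (intro nn_integral_cong) auto
    finally show ?thesis by (simp add: chain_measure_converse)
  qed
  moreover have "chain_measure M R (space M) (Suc 0) = emeasure M (space M)"
    by (simp add: chain_measure_Suc)
  ultimately show ?thesis
    unfolding run_coeff_def measure_def by (cases n) (simp_all only: chain_measure_0 enn2real_1, simp_all)
qed

end

section \<open>Restriction to a measurable subset\<close>

lemma sets_Restr [measurable]:
  assumes "R \<in> sets (M \<Otimes>\<^sub>M M)"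
  shows "Restr R S \<in> sets (restrict_space M S \<Otimes>\<^sub>M restrict_space M S)"
proof -
  have 1: "(\<lambda>x. x) \<in> restrict_space M S \<rightarrow>\<^sub>M M"
    by (rule measurable_restrict_space1) simp
  let ?N = "restrict_space M S \<Otimes>\<^sub>M restrict_space M S"
  have "(\<lambda>p. (fst p, snd p)) \<in> ?N \<rightarrow>\<^sub>M M \<Otimes>\<^sub>M M"
    by (intro measurable_Pair measurable_compose[OF _ 1] measurable_fst measurable_snd)
  from measurable_sets[OF this assms] have "(\<lambda>p. (fst p, snd p)) -` R \<inter> space ?N \<in> sets ?N" .
  moreover have "Restr R S = (\<lambda>p. (fst p, snd p)) -` R \<inter> space ?N"
    using sets.sets_into_space[OF assms] by (auto simp: space_pair_measure space_restrict_space)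
  ultimately show ?thesis by (simp only:)
qed

lemma chain_measure_restrict_space:
  assumes [simp]: "S \<in> sets M"
  shows "chain_measure (restrict_space M S) (Restr R S) S n = chain_measure M R S n"
proof -
  have [simp]: "S \<inter> space M \<in> sets M" by auto
  have "chain_from (restrict_space M S) (Restr R S) S k x = chain_from M R S k x" if "x \<in> S" for k x
    using that
  proof (induction k arbitrary: x)
    case (Suc k)
    show ?case unfolding chain_from.simps
      by (subst nn_integral_restrict_space, simp, intro nn_integral_cong)
         (use Suc in \<open>auto simp: indicator_def\<close>)
  qed simp
  then show ?thesis
    by (cases n) (auto simp: chain_measure_Suc nn_integral_restrict_space indicator_def intro!: nn_integral_cong)
qed

section \<open>Absolutely convergent power series\<close>

text \<open>Absolute convergence at a single point is what Cauchy products and Tannery's theorem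
  require, and it passes to series with smaller coefficients.\<close>

definition abs_converges_at :: "complex fps \<Rightarrow> complex \<Rightarrow> bool" where
  "abs_converges_at f z \<longleftrightarrow> summable (\<lambda>n. norm (fps_nth f n * z ^ n))"

lemma abs_converges_at_imp_converges_at: "abs_converges_at f z \<Longrightarrow> converges_at f z"
  unfolding abs_converges_at_def converges_at_def by (rule summable_norm_cancel)

lemma fps_mult_nth_times_power:
  fixes f g :: "complex fps"
  shows "fps_nth (f * g) n * z ^ n = (\<Sum>i\<le>n. (fps_nth f i * z ^ i) * (fps_nth g (n - i) * z ^ (n - i)))"
  unfolding fps_mult_nth sum_distrib_right atLeast0AtMost
proof (intro sum.cong refl)
  fix i assume "i \<in> {..n}"
  then have "z ^ n = z ^ i * z ^ (n - i)" by (simp flip: power_add)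
  then show "fps_nth f i * fps_nth g (n - i) * z ^ n = (fps_nth f i * z ^ i) * (fps_nth g (n - i) * z ^ (n - i))"
    by simp
qed

lemma eval_fps_mult_abs:
  assumes "abs_converges_at f z" "abs_converges_at g z"
  shows "eval_fps (f * g) z = eval_fps f z * eval_fps g z"
  using Cauchy_product_sums[OF assms[unfolded abs_converges_at_def]]
  unfolding eval_fps_def fps_mult_nth_times_power by (simp add: sums_iff)

lemma abs_converges_at_mult:
  assumes "abs_converges_at f z" "abs_converges_at g z"
  shows "abs_converges_at (f * g) z"
proof -
  have "summable (\<lambda>n. \<Sum>i\<le>n. norm (fps_nth f i * z ^ i) * norm (fps_nth g (n - i) * z ^ (n - i)))"
    using assms unfolding abs_converges_at_def by (intro summable_Cauchy_product) simp_all
  then show ?thesis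
    unfolding abs_converges_at_def
  proof (rule summable_comparison_test'[where N = 0])
    fix n
    show "norm (norm (fps_nth (f * g) n * z ^ n))
        \<le> (\<Sum>i\<le>n. norm (fps_nth f i * z ^ i) * norm (fps_nth g (n - i) * z ^ (n - i)))"
      unfolding fps_mult_nth_times_power real_norm_def abs_norm_cancel
      by (intro sum_norm_le) (simp only: norm_mult order_refl)
  qed
qed

lemma abs_converges_at_0: "abs_converges_at 0 z"
  unfolding abs_converges_at_def by simp

lemma abs_converges_at_1: "abs_converges_at 1 z"
  unfolding abs_converges_at_def by (rule summable_finite[of "{0}"]) auto

lemma eval_fps_prod_abs:
  assumes "finite F" "\<And>i. i \<in> F \<Longrightarrow> abs_converges_at (f i) z"
  shows "abs_converges_at (\<Prod>i\<in>F. f i) z \<and> eval_fps (\<Prod>i\<in>F. f i) z = (\<Prod>i\<in>F. eval_fps (f i) z)"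
  using assms
  by (induction F rule: finite_induct)
     (auto simp: abs_converges_at_1 abs_converges_at_mult eval_fps_mult_abs)

lemma eval_fps_add_abs:
  assumes "abs_converges_at f z" "abs_converges_at g z"
  shows "abs_converges_at (f + g) z \<and> eval_fps (f + g) z = eval_fps f z + eval_fps g z"
proof -
  have "summable (\<lambda>n. norm (fps_nth f n * z ^ n) + norm (fps_nth g n * z ^ n))"
    using assms unfolding abs_converges_at_def by (rule summable_add)
  then have "abs_converges_at (f + g) z"
    unfolding abs_converges_at_def
    by (rule summable_comparison_test'[where N = 0]) (simp add: ring_distribs norm_triangle_ineq)
  moreover have "eval_fps (f + g) z = eval_fps f z + eval_fps g z"
    unfolding eval_fps_def using assms
    by (subst suminf_add) (auto simp: abs_converges_at_def ring_distribs dest: summable_norm_cancel)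
  ultimately show ?thesis ..
qed

lemma eval_fps_sum_abs:
  assumes "finite F" "\<And>i. i \<in> F \<Longrightarrow> abs_converges_at (f i) z"
  shows "abs_converges_at (\<Sum>i\<in>F. f i) z \<and> eval_fps (\<Sum>i\<in>F. f i) z = (\<Sum>i\<in>F. eval_fps (f i) z)"
  using assms
  by (induction F rule: finite_induct)
     (auto simp: eval_fps_add_abs abs_converges_at_0)

section \<open>Countable products and sums\<close>

text \<open>Frees the argument from enumerations: it suffices to describe finite products by a
  function \<open>g\<close> of the finite index set and to know its limit along increasing
  exhaustions of \<open>I\<close>.\<close>

lemma enum_prodI:
  assumes "countable I"
    and fin: "\<And>F. finite F \<Longrightarrow> F \<subseteq> I \<Longrightarrow> (\<Prod>i\<in>F. f i) = g F"
    and lim: "\<And>F. incseq F \<Longrightarrow> (\<And>k. finite (F k)) \<Longrightarrow> (\<Union>k::nat. F k) = I \<Longrightarrow> (\<lambda>k. g (F k)) \<longlonglongrightarrow> l"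
  shows "enum_prod f I l"
proof (cases "finite I")
  case True
  \<comment> \<open>For finite \<open>I\<close> the constant sequence is an admissible
    exhaustion.\<close>
  have "(\<lambda>k::nat. g I) \<longlonglongrightarrow> l"
    using lim[of "\<lambda>_. I"] True by (simp add: incseq_def)
  then have "g I = l" by (simp add: LIMSEQ_const_iff)
  then show ?thesis using True fin[of I] \<open>countable I\<close> by (simp add: enum_prod_def)
next
  case False
  have "(\<lambda>n. \<Prod>k<n. f (e k)) \<longlonglongrightarrow> l" if e: "bij_betw e (UNIV :: nat set) I" for e
  proof -
    have inj: "inj_on e {..<n}" for n
      using e by (meson bij_betw_def inj_on_subset subset_UNIV)
    have sub: "e ` {..<n} \<subseteq> I" for n
      using e by (auto simp: bij_betw_def)
    have "(\<Prod>k<n. f (e k)) = g (e ` {..<n})" for n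
      using fin[OF _ sub, of n] inj[of n] by (simp add: prod.reindex)
    \<comment> \<open>The images of initial segments under the enumeration form an increasing
      exhaustion of \<open>I\<close>.\<close>
    moreover have "(\<lambda>n. g (e ` {..<n})) \<longlonglongrightarrow> l"
    proof (rule lim)
      show "(\<Union>k. e ` {..<k}) = I"
        using e by (auto simp: bij_betw_def)
    qed (auto simp: incseq_def intro!: image_mono)
    ultimately show ?thesis by simp
  qed
  then show ?thesis using False \<open>countable I\<close> by (simp add: enum_prod_def)
qed

lemma enum_sumI:
  assumes "countable I"
    and fin: "\<And>F. finite F \<Longrightarrow> F \<subseteq> I \<Longrightarrow> (\<Sum>i\<in>F. f i) = g F"
    and lim: "\<And>F. incseq F \<Longrightarrow> (\<And>k. finite (F k)) \<Longrightarrow> (\<Union>k::nat. F k) = I \<Longrightarrow> (\<lambda>k. g (F k)) \<longlonglongrightarrow> l"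
  shows "enum_sum f I l"
proof (cases "finite I")
  case True
  have "(\<lambda>k::nat. g I) \<longlonglongrightarrow> l"
    using lim[of "\<lambda>_. I"] True by (simp add: incseq_def)
  then have "g I = l" by (simp add: LIMSEQ_const_iff)
  then show ?thesis using True fin[of I] \<open>countable I\<close> by (simp add: enum_sum_def)
next
  case False
  have "(\<lambda>n. \<Sum>k<n. f (e k)) \<longlonglongrightarrow> l" if e: "bij_betw e (UNIV :: nat set) I" for e
  proof -
    have inj: "inj_on e {..<n}" for n
      using e by (meson bij_betw_def inj_on_subset subset_UNIV)
    have sub: "e ` {..<n} \<subseteq> I" for n
      using e by (auto simp: bij_betw_def)
    have "(\<Sum>k<n. f (e k)) = g (e ` {..<n})" for n
      using fin[OF _ sub, of n] inj[of n] by (simp add: sum.reindex)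
    moreover have "(\<lambda>n. g (e ` {..<n})) \<longlonglongrightarrow> l"
    proof (rule lim)
      show "(\<Union>k. e ` {..<k}) = I"
        using e by (auto simp: bij_betw_def)
    qed (auto simp: incseq_def intro!: image_mono)
    ultimately show ?thesis by simp
  qed
  then show ?thesis using False \<open>countable I\<close> by (simp add: enum_sum_def)
qed

lemma enum_prod_cong:
  assumes "\<And>i. i \<in> I \<Longrightarrow> f i = g i"
  shows "enum_prod f I l \<longleftrightarrow> enum_prod g I l"
proof -
  have "(\<lambda>n. \<Prod>k<n. f (e k)) = (\<lambda>n. \<Prod>k<n. g (e k))" if "bij_betw e (UNIV :: nat set) I" for e
    using that assms by (auto simp: bij_betw_def)
  then show ?thesis using assms by (auto simp: enum_prod_def)
qed

lemma enum_sum_cong: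
  assumes "\<And>i. i \<in> I \<Longrightarrow> f i = g i"
  shows "enum_sum f I l \<longleftrightarrow> enum_sum g I l"
proof -
  have "(\<lambda>n. \<Sum>k<n. f (e k)) = (\<lambda>n. \<Sum>k<n. g (e k))" if "bij_betw e (UNIV :: nat set) I" for e
    using that assms by (auto simp: bij_betw_def)
  then show ?thesis using assms by (auto simp: enum_sum_def)
qed

section \<open>Run functions of compositions\<close>

text \<open>\<open>enn2real\<close> sends infinity to 0, but over a finite measure no information is
  lost, as \<open>ennreal_chain_coeff\<close> shows.\<close>

definition chain_coeff :: "'a measure \<Rightarrow> 'a rel \<Rightarrow> 'a set \<Rightarrow> nat \<Rightarrow> real" where
  "chain_coeff M R S n = enn2real (chain_measure M R S n)"

definition chain_fps :: "'a measure \<Rightarrow> 'a rel \<Rightarrow> 'a set \<Rightarrow> complex fps" where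
  "chain_fps M R S = Abs_fps (\<lambda>n. complex_of_real (chain_coeff M R S n))"

lemma chain_coeff_nonneg [simp]: "0 \<le> chain_coeff M R S n"
  by (simp add: chain_coeff_def)

lemma chain_coeff_0 [simp]: "chain_coeff M R S 0 = 1"
  by (simp add: chain_coeff_def)

lemma chain_fps_nth [simp]: "fps_nth (chain_fps M R S) n = complex_of_real (chain_coeff M R S n)"
  by (simp add: chain_fps_def)

lemma abs_converges_at_chain_fps_iff:
  "abs_converges_at (chain_fps M R S) z \<longleftrightarrow> summable (\<lambda>n. chain_coeff M R S n * norm z ^ n)"
  by (simp add: abs_converges_at_def norm_mult norm_power)

lemma chain_measure_empty: "chain_measure M R {} n = (if n = 0 then 1 else 0)"
  by (cases n) (auto simp: chain_measure_Suc)

lemma chain_fps_empty: "chain_fps M R {} = 1"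
  by (rule fps_ext) (simp add: chain_coeff_def chain_measure_empty)

lemma measurable_partitionD:
  assumes "measurable_partition M \<Gamma> S"
  shows "\<gamma> \<in> \<Gamma> \<Longrightarrow> S \<gamma> \<in> sets M" and "disjoint_family_on S \<Gamma>" and "space M = (\<Union>\<gamma>\<in>\<Gamma>. S \<gamma>)"
  using assms by (auto simp: measurable_partition_def)

context finite_measure
begin

lemma ennreal_chain_coeff: "ennreal (chain_coeff M R S n) = chain_measure M R S n"
  by (simp add: chain_coeff_def chain_measure_finite)

lemma chain_coeff_eqI: "chain_measure M R S n = ennreal c \<Longrightarrow> 0 \<le> c \<Longrightarrow> chain_coeff M R S n = c"
  by (simp add: chain_coeff_def)

lemma chain_coeff_mono: "S \<subseteq> S' \<Longrightarrow> chain_coeff M R S n \<le> chain_coeff M R S' n"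
  unfolding chain_coeff_def by (intro enn2real_mono chain_measure_mono chain_measure_finite)

lemma abs_converges_at_chain_fps_mono:
  assumes "abs_converges_at (chain_fps M R S') z" "S \<subseteq> S'"
  shows "abs_converges_at (chain_fps M R S) z"
  using assms(1) unfolding abs_converges_at_chain_fps_iff
  by (rule summable_comparison_test'[where N = 0])
     (auto simp: abs_mult intro!: mult_right_mono chain_coeff_mono assms(2))

lemma chain_coeff_LIMSEQ:
  assumes "R \<in> sets (M \<Otimes>\<^sub>M M)" "\<And>k. S k \<in> sets M" "incseq S"
  shows "(\<lambda>k. chain_coeff M R (S k) n) \<longlonglongrightarrow> chain_coeff M R (\<Union>k. S k) n"
  using chain_measure_LIMSEQ[OF assms]
  unfolding ennreal_chain_coeff[symmetric] by (subst (asm) tendsto_ennreal_iff) auto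

text \<open>Tannery's theorem: the coefficients converge one by one and are dominated by those of
  the union, whose series converges absolutely at \<open>z\<close>.\<close>

lemma eval_chain_fps_LIMSEQ:
  assumes "R \<in> sets (M \<Otimes>\<^sub>M M)" "\<And>k. S k \<in> sets M" "incseq S"
    and conv: "abs_converges_at (chain_fps M R (\<Union>k. S k)) z"
  shows "(\<lambda>k. eval_fps (chain_fps M R (S k)) z) \<longlonglongrightarrow> eval_fps (chain_fps M R (\<Union>k. S k)) z"
proof -
  have "norm (fps_nth (chain_fps M R (S k)) n * z ^ n) \<le> chain_coeff M R (\<Union>k. S k) n * norm z ^ n" for n k
    by (auto simp: norm_mult norm_power intro!: mult_right_mono chain_coeff_mono)
  then show ?thesis
    using conv unfolding abs_converges_at_chain_fps_iff eval_fps_def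
    by (intro conjunct2[OF conjunct2[OF tannerys_theorem[where
          M = "\<lambda>n. chain_coeff M R (\<Union>k. S k) n * norm z ^ n"]]])
       (auto intro!: always_eventually tendsto_intros chain_coeff_LIMSEQ assms)
qed

lemma chain_fps_Un_series:
  assumes "R \<in> sets (M \<Otimes>\<^sub>M M)" "A \<in> sets M" "B \<in> sets M" "A \<inter> B = {}"
    and "\<And>a b. a \<in> A \<Longrightarrow> b \<in> B \<Longrightarrow> (a, b) \<in> R"
    and "\<And>a b. a \<in> A \<Longrightarrow> b \<in> B \<Longrightarrow> (b, a) \<notin> R"
  shows "chain_fps M R (A \<union> B) = chain_fps M R A * chain_fps M R B"
proof (rule fps_ext)
  fix n
  have "chain_measure M R (A \<union> B) n = (\<Sum>k\<le>n. chain_measure M R A k * chain_measure M R B (n - k))"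
    by (rule chain_measure_Un_series[OF assms])
  also have "\<dots> = ennreal (\<Sum>k\<le>n. chain_coeff M R A k * chain_coeff M R B (n - k))"
    unfolding ennreal_chain_coeff[symmetric] by (simp add: ennreal_mult flip: sum_ennreal)
  finally have "chain_measure M R (A \<union> B) n = ennreal (\<Sum>k\<le>n. chain_coeff M R A k * chain_coeff M R B (n - k))" .
  then have "chain_coeff M R (A \<union> B) n = (\<Sum>k\<le>n. chain_coeff M R A k * chain_coeff M R B (n - k))"
    by (rule chain_coeff_eqI) (simp add: sum_nonneg)
  then show "fps_nth (chain_fps M R (A \<union> B)) n = fps_nth (chain_fps M R A * chain_fps M R B) n"
    by (simp add: fps_mult_nth atLeast0AtMost)
qed

text \<open>Subtracting 1 removes the empty chain, the only one that belongs to both parts.\<close>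

lemma chain_fps_Un_parallel:
  assumes "R \<in> sets (M \<Otimes>\<^sub>M M)" "A \<in> sets M" "B \<in> sets M" "A \<inter> B = {}"
    and "\<And>a b. a \<in> A \<Longrightarrow> b \<in> B \<Longrightarrow> (a, b) \<notin> R \<and> (b, a) \<notin> R"
  shows "chain_fps M R (A \<union> B) - 1 = (chain_fps M R A - 1) + (chain_fps M R B - 1)"
proof (rule fps_ext)
  fix n
  have "chain_coeff M R (A \<union> B) n = chain_coeff M R A n + chain_coeff M R B n" if "n = Suc m" for m
    unfolding that chain_coeff_def
    by (subst chain_measure_Un_parallel[OF assms]) (simp_all add: enn2real_plus chain_measure_finite)
  then show "fps_nth (chain_fps M R (A \<union> B) - 1) n = fps_nth ((chain_fps M R A - 1) + (chain_fps M R B - 1)) n"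
    by (cases n) (simp_all only: fps_sub_nth fps_add_nth chain_fps_nth chain_coeff_0 fps_one_nth, simp_all)
qed

text \<open>A block \<open>S\<close> placed between \<open>L\<close> and \<open>U\<close>
  contributes a factor wherever it sits, since multiplication of power series is commutative. This
  serves both for finite series compositions and for inserting an atom into a total order.\<close>

lemma chain_fps_insert_between:
  assumes R: "R \<in> sets (M \<Otimes>\<^sub>M M)" and meas: "L \<in> sets M" "S \<in> sets M" "U \<in> sets M"
    and disj: "L \<inter> S = {}" "L \<inter> U = {}" "S \<inter> U = {}"
    and LS: "\<And>a b. a \<in> L \<Longrightarrow> b \<in> S \<Longrightarrow> (a, b) \<in> R \<and> (b, a) \<notin> R"
    and LU: "\<And>a b. a \<in> L \<Longrightarrow> b \<in> U \<Longrightarrow> (a, b) \<in> R \<and> (b, a) \<notin> R"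
    and SU: "\<And>a b. a \<in> S \<Longrightarrow> b \<in> U \<Longrightarrow> (a, b) \<in> R \<and> (b, a) \<notin> R"
  shows "chain_fps M R (S \<union> (L \<union> U)) = chain_fps M R S * chain_fps M R (L \<union> U)"
proof -
  have "S \<union> (L \<union> U) = L \<union> (S \<union> U)" by auto
  then have "chain_fps M R (S \<union> (L \<union> U)) = chain_fps M R L * chain_fps M R (S \<union> U)"
    using meas disj LS LU by (simp only:) (intro chain_fps_Un_series R; auto)
  also have "\<dots> = chain_fps M R L * (chain_fps M R S * chain_fps M R U)"
    using meas disj SU by (subst chain_fps_Un_series[OF R]) auto
  also have "\<dots> = chain_fps M R S * chain_fps M R (L \<union> U)"
    using meas disj LU by (subst chain_fps_Un_series[OF R, of L U]) (auto simp: mult_ac)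
  finally show ?thesis .
qed

text \<open>The induction adds indices in no particular order, so a new component may land in the
  middle; this is the situation of \<open>chain_fps_insert_between\<close>.\<close>

lemma chain_fps_UN_series:
  assumes R: "R \<in> sets (M \<Otimes>\<^sub>M M)" and lin: "linear_order_on \<Gamma> rI"
    and meas: "\<And>\<gamma>. \<gamma> \<in> \<Gamma> \<Longrightarrow> S \<gamma> \<in> sets M" and disj: "disjoint_family_on S \<Gamma>"
    and cross: "\<And>\<gamma> \<gamma>' s t. \<gamma> \<in> \<Gamma> \<Longrightarrow> \<gamma>' \<in> \<Gamma> \<Longrightarrow> \<gamma> \<noteq> \<gamma>' \<Longrightarrow> s \<in> S \<gamma> \<Longrightarrow> t \<in> S \<gamma>' \<Longrightarrow>
      (s, t) \<in> R \<longleftrightarrow> (\<gamma>, \<gamma>') \<in> rI"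
    and "finite F" "F \<subseteq> \<Gamma>"
  shows "chain_fps M R (\<Union>\<gamma>\<in>F. S \<gamma>) = (\<Prod>\<gamma>\<in>F. chain_fps M R (S \<gamma>))"
  using \<open>finite F\<close> \<open>F \<subseteq> \<Gamma>\<close>
proof (induction F rule: finite_induct)
  case (insert \<gamma> F)
  have rI: "trans rI" "antisym rI" "total_on \<Gamma> rI"
    using lin by (auto simp: order_on_defs)
  \<comment> \<open>The old indices split into those below and those above the new one.\<close>
  let ?L = "{\<gamma>' \<in> F. (\<gamma>', \<gamma>) \<in> rI}" and ?U = "{\<gamma>' \<in> F. (\<gamma>, \<gamma>') \<in> rI}"
  have F: "F \<subseteq> \<Gamma>" "\<gamma> \<in> \<Gamma>" "\<gamma> \<notin> F" using insert by auto
  have LU: "?L \<union> ?U = F" "?L \<inter> ?U = {}"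
    using F rI by (auto simp: total_on_def dest: antisymD)
  have cross': "(s, t) \<in> R \<and> (t, s) \<notin> R"
    if "\<delta> \<in> \<Gamma>" "\<delta>' \<in> \<Gamma>" "\<delta> \<noteq> \<delta>'" "(\<delta>, \<delta>') \<in> rI" "s \<in> S \<delta>" "t \<in> S \<delta>'" for \<delta> \<delta>' s t
    using that cross[of \<delta> \<delta>' s t] cross[of \<delta>' \<delta> t s] rI(2) by (auto dest: antisymD)
  have "chain_fps M R (S \<gamma> \<union> ((\<Union>\<gamma>\<in>?L. S \<gamma>) \<union> (\<Union>\<gamma>\<in>?U. S \<gamma>)))
      = chain_fps M R (S \<gamma>) * chain_fps M R ((\<Union>\<gamma>\<in>?L. S \<gamma>) \<union> (\<Union>\<gamma>\<in>?U. S \<gamma>))"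
  proof (rule chain_fps_insert_between[OF R])
    have d: "S \<delta> \<inter> S \<delta>' = {}" if "\<delta> \<in> \<Gamma>" "\<delta>' \<in> \<Gamma>" "\<delta> \<noteq> \<delta>'" for \<delta> \<delta>'
      using that by (intro disjoint_family_onD[OF disj])
    have "S \<delta> \<inter> S \<gamma> = {}" if "\<delta> \<in> F" for \<delta> using that F by (intro d) auto
    then show "(\<Union>\<gamma>\<in>?L. S \<gamma>) \<inter> S \<gamma> = {}" "S \<gamma> \<inter> (\<Union>\<gamma>\<in>?U. S \<gamma>) = {}" by blast+
    have "S \<delta> \<inter> S \<delta>' = {}" if "\<delta> \<in> ?L" "\<delta>' \<in> ?U" for \<delta> \<delta>'
      using that F LU(2) by (intro d) auto
    then show "(\<Union>\<gamma>\<in>?L. S \<gamma>) \<inter> (\<Union>\<gamma>\<in>?U. S \<gamma>) = {}" by blast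
    show "(\<Union>\<gamma>\<in>?L. S \<gamma>) \<in> sets M" "S \<gamma> \<in> sets M" "(\<Union>\<gamma>\<in>?U. S \<gamma>) \<in> sets M"
      using F meas \<open>finite F\<close> by (auto intro!: sets.finite_UN)
  next
    fix a b assume "a \<in> (\<Union>\<gamma>\<in>?L. S \<gamma>)" "b \<in> S \<gamma>"
    then show "(a, b) \<in> R \<and> (b, a) \<notin> R" using F cross'[of _ \<gamma> a b] by blast
  next
    fix a b assume "a \<in> S \<gamma>" "b \<in> (\<Union>\<gamma>\<in>?U. S \<gamma>)"
    then show "(a, b) \<in> R \<and> (b, a) \<notin> R" using F cross'[of \<gamma> _ a b] by blast
  next
    fix a b assume "a \<in> (\<Union>\<gamma>\<in>?L. S \<gamma>)" "b \<in> (\<Union>\<gamma>\<in>?U. S \<gamma>)"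
    then obtain \<delta> \<delta>' where *: "\<delta> \<in> ?L" "\<delta>' \<in> ?U" "a \<in> S \<delta>" "b \<in> S \<delta>'" by blast
    then have "(\<delta>, \<delta>') \<in> rI" "\<delta> \<noteq> \<delta>'" using rI(1) LU(2) by (auto dest: transD)
    then show "(a, b) \<in> R \<and> (b, a) \<notin> R" using * F cross'[of \<delta> \<delta>' a b] by blast
  qed
  moreover have "(\<Union>\<gamma>\<in>?L. S \<gamma>) \<union> (\<Union>\<gamma>\<in>?U. S \<gamma>) = (\<Union>\<gamma>\<in>F. S \<gamma>)"
    unfolding UN_Un[symmetric] LU(1) ..
  ultimately show ?case using insert by simp
qed (simp add: chain_fps_empty)

lemma chain_fps_UN_parallel:
  assumes R: "R \<in> sets (M \<Otimes>\<^sub>M M)"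
    and meas: "\<And>\<gamma>. \<gamma> \<in> \<Gamma> \<Longrightarrow> S \<gamma> \<in> sets M" and disj: "disjoint_family_on S \<Gamma>"
    and cross: "\<And>\<gamma> \<gamma>' s t. \<gamma> \<in> \<Gamma> \<Longrightarrow> \<gamma>' \<in> \<Gamma> \<Longrightarrow> \<gamma> \<noteq> \<gamma>' \<Longrightarrow> s \<in> S \<gamma> \<Longrightarrow> t \<in> S \<gamma>' \<Longrightarrow> (s, t) \<notin> R"
    and "finite F" "F \<subseteq> \<Gamma>"
  shows "chain_fps M R (\<Union>\<gamma>\<in>F. S \<gamma>) - 1 = (\<Sum>\<gamma>\<in>F. chain_fps M R (S \<gamma>) - 1)"
  using \<open>finite F\<close> \<open>F \<subseteq> \<Gamma>\<close>
proof (induction F rule: finite_induct)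
  case (insert \<gamma> F)
  have F: "F \<subseteq> \<Gamma>" "\<gamma> \<in> \<Gamma>" "\<gamma> \<notin> F" using insert by auto
  have "chain_fps M R (S \<gamma> \<union> (\<Union>\<gamma>\<in>F. S \<gamma>)) - 1
      = (chain_fps M R (S \<gamma>) - 1) + (chain_fps M R (\<Union>\<gamma>\<in>F. S \<gamma>) - 1)"
  proof (rule chain_fps_Un_parallel[OF R])
    have "S \<gamma> \<inter> S \<delta> = {}" if "\<delta> \<in> F" for \<delta>
      using that F by (intro disjoint_family_onD[OF disj]) auto
    then show "S \<gamma> \<inter> (\<Union>\<gamma>\<in>F. S \<gamma>) = {}" by blast
    show "S \<gamma> \<in> sets M" "(\<Union>\<gamma>\<in>F. S \<gamma>) \<in> sets M"
      using F meas \<open>finite F\<close> by (auto intro!: sets.finite_UN)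
  next
    fix a b assume "a \<in> S \<gamma>" "b \<in> (\<Union>\<gamma>\<in>F. S \<gamma>)"
    then show "(a, b) \<notin> R \<and> (b, a) \<notin> R" using F cross[of \<gamma> _ a b] cross[of _ \<gamma> b a] by blast
  qed
  then show ?case using insert by (simp only: UN_insert sum.insert) simp
qed (simp add: chain_fps_empty)

section \<open>Countable compositions as limits of finite ones\<close>

lemma eval_chain_fps_partition_LIMSEQ:
  assumes R: "R \<in> sets (M \<Otimes>\<^sub>M M)" and part: "measurable_partition M \<Gamma> S"
    and conv: "abs_converges_at (chain_fps M R (space M)) z"
    and F: "incseq F" "\<And>k. finite (F k)" "(\<Union>k. F k) = \<Gamma>"
  shows "(\<lambda>k. eval_fps (chain_fps M R (\<Union>\<gamma>\<in>F k. S \<gamma>)) z) \<longlonglongrightarrow> eval_fps (chain_fps M R (space M)) z"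
proof -
  have eq: "(\<Union>k. \<Union>\<gamma>\<in>F k. S \<gamma>) = space M"
    using F(3) measurable_partitionD(3)[OF part] by blast
  have "(\<lambda>k. eval_fps (chain_fps M R (\<Union>\<gamma>\<in>F k. S \<gamma>)) z)
      \<longlonglongrightarrow> eval_fps (chain_fps M R (\<Union>k. \<Union>\<gamma>\<in>F k. S \<gamma>)) z"
  proof (rule eval_chain_fps_LIMSEQ[OF R])
    show "incseq (\<lambda>k. \<Union>\<gamma>\<in>F k. S \<gamma>)" using F(1) by (fastforce simp: incseq_def)
    show "(\<Union>\<gamma>\<in>F k. S \<gamma>) \<in> sets M" for k
      using F measurable_partitionD(1)[OF part] by (intro sets.finite_UN) auto
    show "abs_converges_at (chain_fps M R (\<Union>k. \<Union>\<gamma>\<in>F k. S \<gamma>)) z" unfolding eq by (rule conv)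
  qed
  then show ?thesis unfolding eq .
qed

text \<open>Finite partial products are run functions of finite subcompositions, and these increase
  to the whole. Absolute convergence for \<open>space M\<close> is inherited by every component. The
  relation \<open>R\<close> is kept general to cover weak and strict chains.\<close>

lemma enum_prod_chain_fps:
  assumes R: "R \<in> sets (M \<Otimes>\<^sub>M M)" and lin: "linear_order_on \<Gamma> rI" and "countable \<Gamma>"
    and part: "measurable_partition M \<Gamma> S"
    and cross: "\<And>\<gamma> \<gamma>' s t. \<gamma> \<in> \<Gamma> \<Longrightarrow> \<gamma>' \<in> \<Gamma> \<Longrightarrow> \<gamma> \<noteq> \<gamma>' \<Longrightarrow> s \<in> S \<gamma> \<Longrightarrow> t \<in> S \<gamma>' \<Longrightarrow>
      (s, t) \<in> R \<longleftrightarrow> (\<gamma>, \<gamma>') \<in> rI"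
    and conv: "abs_converges_at (chain_fps M R (space M)) z"
  shows "enum_prod (\<lambda>\<gamma>. eval_fps (chain_fps M R (S \<gamma>)) z) \<Gamma> (eval_fps (chain_fps M R (space M)) z)"
proof (rule enum_prodI[OF \<open>countable \<Gamma>\<close>])
  note S = measurable_partitionD(1)[OF part] and disj = measurable_partitionD(2)[OF part]
    and UN = measurable_partitionD(3)[OF part, symmetric]
  fix F assume F: "finite F" "F \<subseteq> \<Gamma>"
  have eq: "chain_fps M R (\<Union>\<gamma>\<in>F. S \<gamma>) = (\<Prod>\<gamma>\<in>F. chain_fps M R (S \<gamma>))"
    by (rule chain_fps_UN_series[OF R lin S disj cross F])
  show "(\<Prod>\<gamma>\<in>F. eval_fps (chain_fps M R (S \<gamma>)) z) = eval_fps (chain_fps M R (\<Union>\<gamma>\<in>F. S \<gamma>)) z"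
    unfolding eq using F UN by (subst eval_fps_prod_abs[THEN conjunct2])
      (auto intro!: abs_converges_at_chain_fps_mono[OF conv])
qed (rule eval_chain_fps_partition_LIMSEQ[OF R part conv])


lemma enum_sum_chain_fps:
  assumes R: "R \<in> sets (M \<Otimes>\<^sub>M M)" and "countable \<Gamma>"
    and part: "measurable_partition M \<Gamma> S"
    and cross: "\<And>\<gamma> \<gamma>' s t. \<gamma> \<in> \<Gamma> \<Longrightarrow> \<gamma>' \<in> \<Gamma> \<Longrightarrow> \<gamma> \<noteq> \<gamma>' \<Longrightarrow> s \<in> S \<gamma> \<Longrightarrow> t \<in> S \<gamma>' \<Longrightarrow> (s, t) \<notin> R"
    and conv: "abs_converges_at (chain_fps M R (space M)) z"
  shows "enum_sum (\<lambda>\<gamma>. eval_fps (chain_fps M R (S \<gamma>)) z - 1) \<Gamma> (eval_fps (chain_fps M R (space M)) z - 1)"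
proof (rule enum_sumI[OF \<open>countable \<Gamma>\<close>])
  have minus_1: "abs_converges_at (f - 1) z \<and> eval_fps (f - 1) z = eval_fps f z - 1"
    if "abs_converges_at f z" for f
  proof -
    have "abs_converges_at (- 1) z"
      unfolding abs_converges_at_def by (rule summable_finite[of "{0}"]) auto
    moreover have "eval_fps (- 1) z = - 1"
      unfolding eval_fps_def by (subst suminf_finite[of "{0}"]) auto
    ultimately show ?thesis using eval_fps_add_abs[OF that, of "- 1"] by simp
  qed
  note S = measurable_partitionD(1)[OF part] and disj = measurable_partitionD(2)[OF part]
    and UN = measurable_partitionD(3)[OF part, symmetric]
  fix F assume F: "finite F" "F \<subseteq> \<Gamma>"
  have conv': "abs_converges_at (chain_fps M R (S \<gamma>)) z" if "\<gamma> \<in> F" for \<gamma>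
    using that F UN by (intro abs_converges_at_chain_fps_mono[OF conv]) auto
  have eq: "chain_fps M R (\<Union>\<gamma>\<in>F. S \<gamma>) - 1 = (\<Sum>\<gamma>\<in>F. chain_fps M R (S \<gamma>) - 1)"
    by (rule chain_fps_UN_parallel[OF R S disj cross F])
  have "abs_converges_at (chain_fps M R (\<Union>\<gamma>\<in>F. S \<gamma>)) z"
    using F UN by (intro abs_converges_at_chain_fps_mono[OF conv]) auto
  then have "eval_fps (chain_fps M R (\<Union>\<gamma>\<in>F. S \<gamma>)) z - 1 = eval_fps (chain_fps M R (\<Union>\<gamma>\<in>F. S \<gamma>) - 1) z"
    using minus_1 by simp
  also have "\<dots> = (\<Sum>\<gamma>\<in>F. eval_fps (chain_fps M R (S \<gamma>) - 1) z)"
    unfolding eq using F conv' minus_1 by (subst eval_fps_sum_abs[THEN conjunct2]) auto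
  also have "\<dots> = (\<Sum>\<gamma>\<in>F. eval_fps (chain_fps M R (S \<gamma>)) z - 1)"
    using conv' minus_1 by simp
  finally show "(\<Sum>\<gamma>\<in>F. eval_fps (chain_fps M R (S \<gamma>)) z - 1) = eval_fps (chain_fps M R (\<Union>\<gamma>\<in>F. S \<gamma>)) z - 1" ..
qed (intro tendsto_diff tendsto_const eval_chain_fps_partition_LIMSEQ[OF R part conv])

end

section \<open>Total orders\<close>

lemma countable_incseq_finite:
  assumes "countable A"
  obtains F :: "nat \<Rightarrow> 'a set" where "incseq F" "\<And>k. finite (F k)" "(\<Union>k. F k) = A"
proof
  let ?F = "\<lambda>k. {a \<in> A. to_nat_on A a < k}"
  show "incseq ?F" by (auto simp: incseq_def)
  show "finite (?F k)" for k
    using inj_on_to_nat_on[OF assms]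
    by (intro inj_on_finite[of "to_nat_on A" _ "{..<k}"]) (auto intro: inj_on_subset)
  show "(\<Union>k. ?F k) = A" by auto
qed

text \<open>The measurability of both order relations makes the diagonal, as their difference,
  measurable; its section at \<open>x\<close> is the point \<open>x\<close>.\<close>

lemma measurable_poset_singleton:
  assumes "measurable_poset M r" "x \<in> space M"
  shows "{x} \<in> sets M"
proof -
  have r: "r \<in> sets (M \<Otimes>\<^sub>M M)" "r - Id \<in> sets (M \<Otimes>\<^sub>M M)" "refl_on (space M) r"
    using assms by (auto simp: measurable_poset_def partial_order_on_def preorder_on_def)
  have "r - (r - Id) \<in> sets (M \<Otimes>\<^sub>M M)" using r by auto
  from sets_Pair1[OF this, of x] have "Pair x -` (r - (r - Id)) \<in> sets M" .
  also have "Pair x -` (r - (r - Id)) = {x}"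
    using r(3) assms(2) by (auto simp: refl_on_def)
  finally show ?thesis .
qed

lemma exp_sums_over_fact:
  fixes x :: "'a::{real_normed_field,banach}"
  shows "(\<lambda>n. x ^ n / fact n) sums exp x"
  using exp_converges[of x] by (simp add: scaleR_conv_of_real field_simps)

lemma ennreal_fact: "ennreal (fact n) = fact n"
  by (metis ennreal_of_nat_eq_real_of_nat of_nat_fact)

section \<open>Strict chains, diffuse sets and single atoms\<close>

context finite_measure
begin

lemma chain_coeff_le_fact:
  assumes "R \<in> sets (M \<Otimes>\<^sub>M M)" "trans R" "irrefl R"
  shows "chain_coeff M R (space M) n \<le> measure M (space M) ^ n / fact n"
proof -
  have "ennreal (fact n * chain_coeff M R (space M) n) = fact n * chain_measure M R (space M) n"
    by (subst ennreal_mult) (auto simp: ennreal_chain_coeff ennreal_fact)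
  also have "\<dots> \<le> emeasure M (space M) ^ n"
    using assms by (intro fact_times_chain_measure_le) auto
  also have "\<dots> = ennreal (measure M (space M) ^ n)"
    by (simp add: emeasure_eq_measure ennreal_power)
  finally show ?thesis by (simp add: field_simps)
qed

text \<open>Comparison with the exponential series, by the factorial bound on the
  coefficients.\<close>

lemma abs_converges_at_strict:
  assumes "R \<in> sets (M \<Otimes>\<^sub>M M)" "trans R" "irrefl R"
  shows "abs_converges_at (chain_fps M R (space M)) z"
  unfolding abs_converges_at_chain_fps_iff
proof (rule summable_comparison_test'[where N = 0])
  show "summable (\<lambda>n. (measure M (space M) * norm z) ^ n / fact n)"
    using exp_sums_over_fact by (rule sums_summable)
  fix n
  have "chain_coeff M R (space M) n * norm z ^ n \<le> measure M (space M) ^ n / fact n * norm z ^ n"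
    by (intro mult_right_mono chain_coeff_le_fact assms) simp
  then show "norm (chain_coeff M R (space M) n * norm z ^ n) \<le> (measure M (space M) * norm z) ^ n / fact n"
    by (simp add: power_mult_distrib)
qed

lemma chain_coeff_diffuse:
  assumes "R \<in> sets (M \<Otimes>\<^sub>M M)" "S \<in> sets M" "trans R" "irrefl R"
    and "total_on S R" and "\<And>x. x \<in> S \<Longrightarrow> {x} \<in> null_sets M"
  shows "chain_coeff M R S n = measure M S ^ n / fact n"
proof -
  have "ennreal (fact n * chain_coeff M R S n) = fact n * chain_measure M R S n"
    by (subst ennreal_mult) (auto simp: ennreal_chain_coeff ennreal_fact)
  also have "\<dots> = emeasure M S ^ n"
    using assms by (rule fact_times_chain_measure_diffuse)
  also have "\<dots> = ennreal (measure M S ^ n)"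
    by (simp add: emeasure_eq_measure ennreal_power)
  finally show ?thesis by (simp add: field_simps)
qed

text \<open>Only the coefficients are assumed, so that the weak and the strict relation are treated
  alike.\<close>

lemma eval_chain_fps_diffuse:
  assumes "\<And>n. chain_coeff M R S n = measure M S ^ n / fact n"
  shows "abs_converges_at (chain_fps M R S) z"
    and "eval_fps (chain_fps M R S) z = exp (complex_of_real (measure M S) * z)"
proof -
  have "(\<lambda>n. chain_coeff M R S n * norm z ^ n) sums exp (measure M S * norm z)"
    using exp_sums_over_fact[of "measure M S * norm z"] by (simp add: assms power_mult_distrib)
  then show "abs_converges_at (chain_fps M R S) z"
    unfolding abs_converges_at_chain_fps_iff by (rule sums_summable)
  have "(\<lambda>n. fps_nth (chain_fps M R S) n * z ^ n) sums exp (complex_of_real (measure M S) * z)"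
    using exp_sums_over_fact[of "complex_of_real (measure M S) * z"] by (simp add: assms power_mult_distrib)
  then show "eval_fps (chain_fps M R S) z = exp (complex_of_real (measure M S) * z)"
    unfolding eval_fps_def by (rule sums_unique[symmetric])
qed

lemma eval_chain_fps_singleton_irrefl:
  assumes "{x} \<in> sets M" "(x, x) \<notin> R"
  shows "abs_converges_at (chain_fps M R {x}) z"
    and "eval_fps (chain_fps M R {x}) z = 1 + complex_of_real (measure M {x}) * z"
proof -
  have c: "chain_coeff M R {x} n = (if n = 0 then 1 else if n = 1 then measure M {x} else 0)" for n
    unfolding chain_coeff_def chain_measure_singleton_irrefl[OF assms] by (simp add: measure_def)
  show "abs_converges_at (chain_fps M R {x}) z"
    unfolding abs_converges_at_def by (rule summable_finite[of "{0, 1}"]) (auto simp: c)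
  show "eval_fps (chain_fps M R {x}) z = 1 + complex_of_real (measure M {x}) * z"
    unfolding eval_fps_def by (subst suminf_finite[of "{0, 1}"]) (auto simp: c)
qed

lemma eval_chain_fps_singleton:
  assumes "{x} \<in> sets M" "(x, x) \<in> R" "measure M {x} * norm z < 1"
  shows "abs_converges_at (chain_fps M R {x}) z"
    and "eval_fps (chain_fps M R {x}) z = 1 / (1 - complex_of_real (measure M {x}) * z)"
proof -
  have c: "chain_coeff M R {x} n = measure M {x} ^ n" for n
    unfolding chain_coeff_def chain_measure_singleton[OF assms(1,2)]
    by (simp add: emeasure_eq_measure ennreal_power)
  have "summable (\<lambda>n. (measure M {x} * norm z) ^ n)"
    using assms(3) by (intro summable_geometric) simp
  then show "abs_converges_at (chain_fps M R {x}) z"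
    unfolding abs_converges_at_chain_fps_iff by (simp add: c power_mult_distrib)
  have "(\<lambda>n. (complex_of_real (measure M {x}) * z) ^ n) sums (1 / (1 - complex_of_real (measure M {x}) * z))"
    using assms(3) by (intro geometric_sums) (simp add: norm_mult)
  then have "(\<lambda>n. fps_nth (chain_fps M R {x}) n * z ^ n) sums (1 / (1 - complex_of_real (measure M {x}) * z))"
    by (simp add: c power_mult_distrib)
  then show "eval_fps (chain_fps M R {x}) z = 1 / (1 - complex_of_real (measure M {x}) * z)"
    unfolding eval_fps_def by (rule sums_unique[symmetric])
qed

lemma countable_atoms: "countable (atoms M)"
  by (rule countable_subset[OF _ countable_support]) (auto simp: atoms_def)

lemma sets_atoms:
  assumes "measurable_poset M r" "F \<subseteq> atoms M"
  shows "F \<in> sets M"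
  using assms measurable_poset_singleton[OF assms(1)] countable_subset[OF assms(2) countable_atoms]
  by (intro sets.countable[where A = F]) (auto simp: atoms_def)

lemma sets_diffuse_Un_atoms:
  assumes "measurable_poset M r" "F \<subseteq> atoms M"
  shows "(space M - atoms M) \<union> F \<in> sets M"
  by (rule sets.Un[OF sets.Diff[OF sets.top] ]; rule sets_atoms[OF assms(1)]; use assms(2) in auto)

section \<open>Inserting atoms into a total order\<close>

text \<open>In a total order \<open>x\<close> sits between its predecessors and its successors in
  \<open>S\<close>, so it can be inserted there although \<open>S\<close> as a whole is neither
  below nor above it.\<close>

lemma chain_fps_insert_total:
  assumes R: "R \<in> sets (M \<Otimes>\<^sub>M M)" and S: "S \<in> sets M" "{x} \<in> sets M" and "x \<notin> S"
    and R': "trans R" "antisym R" "total_on (insert x S) R"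
  shows "chain_fps M R (insert x S) = chain_fps M R {x} * chain_fps M R S"
proof -
  let ?L = "{y \<in> S. (y, x) \<in> R}" and ?U = "{y \<in> S. (x, y) \<in> R}"
  have eq: "?L \<union> ?U = S" using R'(3) \<open>x \<notin> S\<close> by (auto simp: total_on_def)
  have anti: "(b, a) \<notin> R" if "(a, b) \<in> R" "a \<noteq> b" for a b
    using that R'(2) by (auto dest: antisymD)
  have "chain_fps M R ({x} \<union> (?L \<union> ?U)) = chain_fps M R {x} * chain_fps M R (?L \<union> ?U)"
  proof (rule chain_fps_insert_between[OF R])
    fix a b assume ab: "a \<in> ?L" "b \<in> ?U"
    then have "(a, b) \<in> R" using R'(1) by (auto dest: transD)
    \<comment> \<open>A common element would lie on both sides of \<open>x\<close>, against
      antisymmetry.\<close>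
    moreover have "a \<noteq> b" using ab \<open>x \<notin> S\<close> anti by auto
    ultimately show "(a, b) \<in> R \<and> (b, a) \<notin> R" using anti by auto
  qed (use S \<open>x \<notin> S\<close> anti sets_predecessors[OF R S(1)] sets_successors[OF R S(1)] in auto)
  then show ?thesis unfolding eq by simp
qed

lemma chain_fps_Un_atoms:
  assumes M: "measurable_poset M r" and R: "R \<in> sets (M \<Otimes>\<^sub>M M)"
    and R': "trans R" "antisym R" "total_on (space M) R"
    and F: "finite F" "F \<subseteq> atoms M"
  shows "chain_fps M R ((space M - atoms M) \<union> F)
    = chain_fps M R (space M - atoms M) * (\<Prod>\<alpha>\<in>F. chain_fps M R {\<alpha>})"
  using F
proof (induction F rule: finite_induct)
  case (insert \<alpha> F)
  have "\<alpha> \<in> space M" "F \<subseteq> space M" using insert.prems by (auto simp: atoms_def)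
  then have "chain_fps M R (insert \<alpha> ((space M - atoms M) \<union> F))
      = chain_fps M R {\<alpha>} * chain_fps M R ((space M - atoms M) \<union> F)"
    using insert M R'
    by (intro chain_fps_insert_total[OF R])
       (auto intro!: sets_diffuse_Un_atoms[OF M] measurable_poset_singleton total_on_subset[OF R'(3)])
  then show ?case using insert by (simp add: mult_ac)
qed simp

lemma eval_chain_fps_Un_atoms:
  assumes M: "measurable_poset M r" and R: "R \<in> sets (M \<Otimes>\<^sub>M M)"
    and R': "trans R" "antisym R" "total_on (space M) R"
    and diffuse: "\<And>n. chain_coeff M R (space M - atoms M) n = diffuse_mass M ^ n / fact n"
    and atom: "\<And>\<alpha>. \<alpha> \<in> atoms M \<Longrightarrow> abs_converges_at (chain_fps M R {\<alpha>}) z"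
      "\<And>\<alpha>. \<alpha> \<in> atoms M \<Longrightarrow> eval_fps (chain_fps M R {\<alpha>}) z = f \<alpha>"
    and F: "finite F" "F \<subseteq> atoms M"
  shows "abs_converges_at (chain_fps M R ((space M - atoms M) \<union> F)) z"
    and "eval_fps (chain_fps M R ((space M - atoms M) \<union> F)) z
      = exp (complex_of_real (diffuse_mass M) * z) * (\<Prod>\<alpha>\<in>F. f \<alpha>)"
proof -
  note D = eval_chain_fps_diffuse[OF diffuse[unfolded diffuse_mass_def], folded diffuse_mass_def]
  have "abs_converges_at (\<Prod>\<alpha>\<in>F. chain_fps M R {\<alpha>}) z \<and>
    eval_fps (\<Prod>\<alpha>\<in>F. chain_fps M R {\<alpha>}) z = (\<Prod>\<alpha>\<in>F. eval_fps (chain_fps M R {\<alpha>}) z)"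
    using F(2) by (intro eval_fps_prod_abs[OF F(1)] atom) blast
  then have A: "abs_converges_at (\<Prod>\<alpha>\<in>F. chain_fps M R {\<alpha>}) z"
    "eval_fps (\<Prod>\<alpha>\<in>F. chain_fps M R {\<alpha>}) z = (\<Prod>\<alpha>\<in>F. eval_fps (chain_fps M R {\<alpha>}) z)"
    by blast+
  have B: "(\<Prod>\<alpha>\<in>F. eval_fps (chain_fps M R {\<alpha>}) z) = (\<Prod>\<alpha>\<in>F. f \<alpha>)"
    using atom(2) F(2) by (intro prod.cong) auto
  show "abs_converges_at (chain_fps M R ((space M - atoms M) \<union> F)) z"
    unfolding chain_fps_Un_atoms[OF M R R' F] by (intro abs_converges_at_mult D A)
  show "eval_fps (chain_fps M R ((space M - atoms M) \<union> F)) z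
      = exp (complex_of_real (diffuse_mass M) * z) * (\<Prod>\<alpha>\<in>F. f \<alpha>)"
    unfolding chain_fps_Un_atoms[OF M R R' F] by (simp add: eval_fps_mult_abs D A B)
qed

lemma incseq_Un_atoms:
  assumes "measurable_poset M r" "incseq F" "(\<Union>k. F k) = atoms M"
  shows "incseq (\<lambda>k. (space M - atoms M) \<union> F k)"
    and "(\<Union>k. (space M - atoms M) \<union> F k) = space M"
    and "(space M - atoms M) \<union> F k \<in> sets M"
proof -
  show "incseq (\<lambda>k. (space M - atoms M) \<union> F k)"
    using assms(2) by (fastforce simp: incseq_def)
  show "(\<Union>k. (space M - atoms M) \<union> F k) = space M"
    using assms(3) by (auto simp: atoms_def)
  show "(space M - atoms M) \<union> F k \<in> sets M"
    using assms(3) by (intro sets_diffuse_Un_atoms[OF assms(1)]) auto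
qed

text \<open>Covers both product formulas: \<open>f\<close> is the run function of a single atom for
  the relation \<open>R\<close>. The diffuse part together with finitely many atoms exhausts the
  space.\<close>

lemma enum_prod_atoms:
  assumes M: "measurable_poset M r" and R: "R \<in> sets (M \<Otimes>\<^sub>M M)"
    and R': "trans R" "antisym R" "total_on (space M) R"
    and diffuse: "\<And>n. chain_coeff M R (space M - atoms M) n = diffuse_mass M ^ n / fact n"
    and atom: "\<And>\<alpha>. \<alpha> \<in> atoms M \<Longrightarrow> abs_converges_at (chain_fps M R {\<alpha>}) z"
      "\<And>\<alpha>. \<alpha> \<in> atoms M \<Longrightarrow> eval_fps (chain_fps M R {\<alpha>}) z = f \<alpha>"
    and conv: "abs_converges_at (chain_fps M R (space M)) z"
  shows "\<exists>p. enum_prod f (atoms M) p \<and>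
    eval_fps (chain_fps M R (space M)) z = exp (complex_of_real (diffuse_mass M) * z) * p"
proof -
  let ?e = "exp (complex_of_real (diffuse_mass M) * z)"
  \<comment> \<open>The exponential never vanishes, so the limit of the partial products over the
    atoms is this quotient.\<close>
  have "enum_prod f (atoms M) (eval_fps (chain_fps M R (space M)) z / ?e)"
  proof (rule enum_prodI[OF countable_atoms])
    fix F assume F: "finite F" "F \<subseteq> atoms M"
    have "eval_fps (chain_fps M R ((space M - atoms M) \<union> F)) z = ?e * (\<Prod>\<alpha>\<in>F. f \<alpha>)"
      by (rule eval_chain_fps_Un_atoms(2)[OF M R R' diffuse atom F])
    then show "(\<Prod>\<alpha>\<in>F. f \<alpha>) = eval_fps (chain_fps M R ((space M - atoms M) \<union> F)) z / ?e"
      by simp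
  next
    fix F :: "nat \<Rightarrow> 'a set" assume F: "incseq F" "\<And>k. finite (F k)" "(\<Union>k. F k) = atoms M"
    note D = incseq_Un_atoms[OF M F(1,3)]
    have "(\<lambda>k. eval_fps (chain_fps M R ((space M - atoms M) \<union> F k)) z)
        \<longlonglongrightarrow> eval_fps (chain_fps M R (\<Union>k. (space M - atoms M) \<union> F k)) z"
      using conv D by (intro eval_chain_fps_LIMSEQ[OF R]) auto
    then show "(\<lambda>k. eval_fps (chain_fps M R ((space M - atoms M) \<union> F k)) z / ?e)
        \<longlonglongrightarrow> eval_fps (chain_fps M R (space M)) z / ?e"
      unfolding D(2) by (intro tendsto_divide tendsto_const) auto
  qed
  then show ?thesis by (intro exI conjI) auto
qed

end

section \<open>Absolute convergence of weak runs in a total order\<close>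

text \<open>Turns a product over atoms into the exponential of a sum of masses, which the total mass
  controls.\<close>

lemma inverse_le_exp:
  fixes t q :: real
  assumes "0 \<le> t" "t \<le> q" "q < 1"
  shows "1 / (1 - t) \<le> exp (t / (1 - q))"
proof -
  have "1 / (1 - t) = 1 + t / (1 - t)" using assms by (simp add: field_simps)
  also have "\<dots> \<le> exp (t / (1 - t))" by (rule exp_ge_add_one_self)
  also have "\<dots> \<le> exp (t / (1 - q))" using assms by (simp add: frac_le)
  finally show ?thesis .
qed

context finite_measure
begin

text \<open>All partial sums, with any finite set of atoms, are at most
  \<open>exp (?\<mu> * ?t / (1 - q))\<close>. The bound survives the exhaustion of the atoms, and
  bounded partial sums of nonnegative terms converge.\<close>

lemma abs_converges_at_total:
  assumes M: "measurable_poset M r" and total: "total_on (space M) r"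
    and diffuse: "\<And>n. chain_coeff M r (space M - atoms M) n = diffuse_mass M ^ n / fact n"
    and q: "0 \<le> q" "q < 1" "\<And>\<alpha>. \<alpha> \<in> atoms M \<Longrightarrow> measure M {\<alpha>} * norm z \<le> q"
  shows "abs_converges_at (chain_fps M r (space M)) z"
proof -
  let ?D = "space M - atoms M" and ?t = "norm z" and ?\<mu> = "measure M (space M)"
  have r: "r \<in> sets (M \<Otimes>\<^sub>M M)" "trans r" "antisym r" "refl_on (space M) r"
    using M by (auto simp: measurable_poset_def partial_order_on_def preorder_on_def)
  have sing: "{\<alpha>} \<in> sets M" "(\<alpha>, \<alpha>) \<in> r" if "\<alpha> \<in> atoms M" for \<alpha>
    using that measurable_poset_singleton[OF M] r(4) by (auto simp: atoms_def refl_on_def)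
  have lt: "measure M {\<alpha>} * norm (complex_of_real ?t) < 1" if "\<alpha> \<in> atoms M" for \<alpha>
    using q(2) q(3)[OF that] by simp
  have bound: "(\<Sum>n<N. chain_coeff M r (?D \<union> F) n * ?t ^ n) \<le> exp (?\<mu> * ?t / (1 - q))"
    if F: "finite F" "F \<subseteq> atoms M" for F N
  proof -
    let ?f = "chain_fps M r (?D \<union> F)"
    note at = eval_chain_fps_singleton[OF sing lt]
    have E: "abs_converges_at ?f (complex_of_real ?t)"
      "eval_fps ?f (complex_of_real ?t) = exp (complex_of_real (diffuse_mass M) * complex_of_real ?t)
        * (\<Prod>\<alpha>\<in>F. 1 / (1 - complex_of_real (measure M {\<alpha>}) * complex_of_real ?t))"
      by (rule eval_chain_fps_Un_atoms[OF M r(1-3) total diffuse at F]; assumption)+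
    have sm: "summable (\<lambda>n. chain_coeff M r (?D \<union> F) n * ?t ^ n)"
      using E(1) by (simp add: abs_converges_at_chain_fps_iff)
    \<comment> \<open>The complex formula is evaluated at the real point \<open>norm z\<close>,
      where it gives the sum of the absolute values.\<close>
    have "complex_of_real (\<Sum>n. chain_coeff M r (?D \<union> F) n * ?t ^ n) = eval_fps ?f (complex_of_real ?t)"
      unfolding eval_fps_def by (subst suminf_of_real[OF sm]) simp
    also have "\<dots> = complex_of_real (exp (diffuse_mass M * ?t) * (\<Prod>\<alpha>\<in>F. 1 / (1 - measure M {\<alpha>} * ?t)))"
      unfolding E(2) by (simp add: exp_of_real[symmetric])
    finally have eq: "(\<Sum>n. chain_coeff M r (?D \<union> F) n * ?t ^ n)
        = exp (diffuse_mass M * ?t) * (\<Prod>\<alpha>\<in>F. 1 / (1 - measure M {\<alpha>} * ?t))"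
      unfolding of_real_eq_iff .
    have "(\<Prod>\<alpha>\<in>F. 1 / (1 - measure M {\<alpha>} * ?t)) \<le> (\<Prod>\<alpha>\<in>F. exp (measure M {\<alpha>} * ?t / (1 - q)))"
      using F q lt by (intro prod_mono conjI inverse_le_exp) (auto simp: less_imp_le subset_eq)
    also have "\<dots> = exp (measure M F * ?t / (1 - q))"
      using F sing
      by (subst finite_measure_eq_sum_singleton)
         (auto simp: exp_sum[symmetric] sum_distrib_right sum_divide_distrib)
    finally have P: "(\<Prod>\<alpha>\<in>F. 1 / (1 - measure M {\<alpha>} * ?t)) \<le> exp (measure M F * ?t / (1 - q))" .
    have D: "?D \<in> sets M" "F \<in> sets M" using F(2) by (auto intro: sets_atoms[OF M])
    \<comment> \<open>Since \<open>1 - q\<close> is positive and at most 1, dividing by it only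
      increases the exponent; with the common denominator the diffuse and atomic masses add
      up.\<close>
    have "exp (diffuse_mass M * ?t) \<le> exp (diffuse_mass M * ?t / (1 - q))"
      using q frac_le[of "diffuse_mass M * ?t" "diffuse_mass M * ?t" "1 - q" 1]
      by (simp add: diffuse_mass_def)
    with P have "exp (diffuse_mass M * ?t) * (\<Prod>\<alpha>\<in>F. 1 / (1 - measure M {\<alpha>} * ?t))
        \<le> exp (diffuse_mass M * ?t / (1 - q)) * exp (measure M F * ?t / (1 - q))"
      using lt by (intro mult_mono prod_nonneg) (use F in \<open>auto simp: less_imp_le\<close>)
    also have "\<dots> = exp (measure M (?D \<union> F) * ?t / (1 - q))"
      using F D by (subst finite_measure_Union)
        (auto simp: diffuse_mass_def exp_add[symmetric] add_divide_distrib distrib_right)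
    also have "\<dots> \<le> exp (?\<mu> * ?t / (1 - q))"
      using q by (auto intro!: divide_right_mono mult_right_mono bounded_measure)
    finally have "(\<Sum>n. chain_coeff M r (?D \<union> F) n * ?t ^ n) \<le> exp (?\<mu> * ?t / (1 - q))"
      unfolding eq .
    moreover have "(\<Sum>n<N. chain_coeff M r (?D \<union> F) n * ?t ^ n)
        \<le> (\<Sum>n. chain_coeff M r (?D \<union> F) n * ?t ^ n)"
      by (intro sum_le_suminf sm) auto
    ultimately show ?thesis by linarith
  qed
  obtain F :: "nat \<Rightarrow> 'a set" where F: "incseq F" "\<And>k. finite (F k)" "(\<Union>k. F k) = atoms M"
    using countable_incseq_finite[OF countable_atoms] by blast
  note A = incseq_Un_atoms[OF M F(1,3)]
  \<comment> \<open>For fixed \<open>N\<close> the finite sum converges along the exhaustion, and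
    the bound depends on neither \<open>k\<close> nor \<open>N\<close>.\<close>
  have "(\<Sum>n<N. chain_coeff M r (space M) n * ?t ^ n) \<le> exp (?\<mu> * ?t / (1 - q))" for N
  proof (rule LIMSEQ_le_const2)
    have "(\<lambda>k. \<Sum>n<N. chain_coeff M r (?D \<union> F k) n * ?t ^ n)
        \<longlonglongrightarrow> (\<Sum>n<N. chain_coeff M r (\<Union>k. ?D \<union> F k) n * ?t ^ n)"
      using A by (intro tendsto_sum tendsto_mult tendsto_const chain_coeff_LIMSEQ r) auto
    then show "(\<lambda>k. \<Sum>n<N. chain_coeff M r (?D \<union> F k) n * ?t ^ n)
        \<longlonglongrightarrow> (\<Sum>n<N. chain_coeff M r (space M) n * ?t ^ n)"
      unfolding A(2) .
    show "\<exists>K. \<forall>k\<ge>K. (\<Sum>n<N. chain_coeff M r (?D \<union> F k) n * ?t ^ n) \<le> exp (?\<mu> * ?t / (1 - q))"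
    proof (intro exI allI impI)
      fix k
      have "F k \<subseteq> atoms M" using F(3) by auto
      then show "(\<Sum>n<N. chain_coeff M r (?D \<union> F k) n * ?t ^ n) \<le> exp (?\<mu> * ?t / (1 - q))"
        by (rule bound[OF F(2)])
    qed
  qed
  then show ?thesis
    unfolding abs_converges_at_chain_fps_iff by (intro summableI_nonneg_bounded) auto
qed

end

section \<open>The run functions in terms of iterated integrals\<close>

text \<open>Lets every fact about strict runs be read off from the weak case, applied to
  \<open>r - Id\<close>.\<close>

lemma run_lt_eq_run_le: "run_lt M r = run_le M (r - Id)"
  by (simp add: run_lt_def run_le_def)

context finite_measure
begin

lemma run_le_eq_chain_fps:
  assumes "R \<in> sets (M \<Otimes>\<^sub>M M)"
  shows "run_le M R = chain_fps M R (space M)"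
  using run_coeff_eq_chain_measure[OF assms] by (simp add: run_le_def chain_fps_def chain_coeff_def)

lemma run_le_restrict_space:
  assumes "R \<in> sets (M \<Otimes>\<^sub>M M)" "S \<in> sets M"
  shows "run_le (restrict_space M S) (Restr R S) = chain_fps M R S"
proof -
  interpret S: finite_measure "restrict_space M S"
    by (rule finite_measure_restrict_space[OF finite_measure_axioms assms(2)])
  have "space (restrict_space M S) = S"
    using sets.sets_into_space[OF assms(2)] by (auto simp: space_restrict_space)
  then show ?thesis
    unfolding S.run_le_eq_chain_fps[OF sets_Restr[OF assms(1)]]
    by (simp add: chain_fps_def chain_coeff_def chain_measure_restrict_space[OF assms(2)])
qed

section \<open>The diffuse part and the masses of the atoms in a total order\<close>

lemma chain_coeff_diffuse_part:
  assumes M: "measurable_poset M r" and lin: "linear_order_on (space M) r"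
  shows "chain_coeff M (r - Id) (space M - atoms M) n = diffuse_mass M ^ n / fact n"
    and "chain_coeff M r (space M - atoms M) n = diffuse_mass M ^ n / fact n"
proof -
  let ?D = "space M - atoms M"
  have null: "{x} \<in> null_sets M" if "x \<in> ?D" for x
  proof -
    have "measure M {x} = 0" using that measure_nonneg[of M "{x}"] by (auto simp: atoms_def)
    then show ?thesis
      using that measurable_poset_singleton[OF M] by (simp add: null_sets_def emeasure_eq_measure)
  qed
  have "r - Id \<in> sets (M \<Otimes>\<^sub>M M)" using M by (simp add: measurable_poset_def)
  moreover have "strict_linear_order_on (space M) (r - Id)"
    by (rule strict_linear_order_on_diff_Id[OF lin])
  ultimately show "chain_coeff M (r - Id) ?D n = diffuse_mass M ^ n / fact n"
    unfolding diffuse_mass_def using null sets_atoms[OF M subset_refl]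
    by (intro chain_coeff_diffuse)
       (auto simp: strict_linear_order_on_def intro: total_on_subset)
  moreover have "chain_measure M (r - Id) ?D n = chain_measure M r ?D n"
    by (rule chain_measure_diff_Id_diffuse[OF null])
  ultimately show "chain_coeff M r ?D n = diffuse_mass M ^ n / fact n"
    by (simp add: chain_coeff_def)
qed

text \<open>At most one atom can carry more than half of the total mass. If there is one, it is the
  heaviest, and its share of the total, less than 1 by non-degeneracy, serves as \<open>q\<close>;
  otherwise \<open>q\<close> is one half.\<close>

lemma nondegenerate_atoms_bound:
  assumes M: "measurable_poset M r" and "\<not> degenerate M"
    and z: "ennreal (norm (z::complex)) \<le> 1 / emeasure M (space M)"
  obtains q where "0 \<le> q" "q < 1" "\<And>\<alpha>. \<alpha> \<in> atoms M \<Longrightarrow> measure M {\<alpha>} * norm z \<le> q"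
proof (cases "measure M (space M) = 0")
  \<comment> \<open>Here 1 divided by the total mass is infinite and \<open>z\<close> is arbitrary,
    but there are no atoms to bound.\<close>
  case True
  then have "\<not> measure M {\<alpha>} > 0" for \<alpha>
    using bounded_measure[of "{\<alpha>}"] by simp
  then have "atoms M = {}" by (simp add: atoms_def)
  then show ?thesis using that[of 0] by simp
next
  case False
  define a where "a = measure M (space M)"
  have a: "a > 0" using False measure_nonneg[of M "space M"] unfolding a_def by linarith
  have "1 / emeasure M (space M) = ennreal (1 / a)"
    using a divide_ennreal[of 1 a] by (simp add: emeasure_eq_measure a_def)
  then have t: "norm z \<le> 1 / a" using z a by simp
  have le: "measure M {\<alpha>} * norm z \<le> q" if "measure M {\<alpha>} \<le> q * a" for \<alpha> q
  proof -
    have "measure M {\<alpha>} * norm z \<le> (q * a) * (1 / a)"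
      using that t a order_trans[OF measure_nonneg that] by (intro mult_mono) auto
    then show ?thesis using a by simp
  qed
  show ?thesis
  proof (cases "\<exists>\<alpha>\<in>atoms M. measure M {\<alpha>} > a / 2")
    case True
    then obtain \<alpha> where \<alpha>: "\<alpha> \<in> atoms M" "measure M {\<alpha>} > a / 2" by blast
    have sing: "{\<beta>} \<in> sets M" if "\<beta> \<in> atoms M" for \<beta>
      using that measurable_poset_singleton[OF M] by (auto simp: atoms_def)
    have "measure M {\<alpha>} \<noteq> a"
      using \<open>\<not> degenerate M\<close> \<alpha> by (auto simp: degenerate_def atoms_def a_def)
    then have lt: "measure M {\<alpha>} < a"
      using bounded_measure[of "{\<alpha>}"] unfolding a_def by linarith
    \<comment> \<open>Two distinct atoms have joint mass at most \<open>a\<close>, so any other atom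
      is lighter than \<open>a / 2\<close>.\<close>
    have "measure M {\<beta>} \<le> measure M {\<alpha>}" if "\<beta> \<in> atoms M" for \<beta>
    proof (cases "\<beta> = \<alpha>")
      case False
      then have "measure M {\<alpha>} + measure M {\<beta>} = measure M ({\<alpha>} \<union> {\<beta>})"
        using sing \<alpha>(1) that by (intro finite_measure_Union[symmetric]) auto
      also have "\<dots> \<le> a" unfolding a_def by (rule bounded_measure)
      finally show ?thesis using \<alpha>(2) by linarith
    qed simp
    then show ?thesis
      using that[of "measure M {\<alpha>} / a"] lt a le[of _ "measure M {\<alpha>} / a"] by auto
  next
    case False
    then show ?thesis using that[of "1 / 2"] le[of _ "1 / 2"] by force
  qed
qed

end

section \<open>The trichotomy and the rules for total orders and compositions\<close>

lemma countably_series_parallel_cases: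
  assumes "countably_series_parallel M r"
  shows "linear_order_on (space M) r \<or>
      (\<exists>(\<Gamma> :: nat set) rI S. series_composition M r \<Gamma> rI S \<and>
         (\<forall>\<gamma>\<in>\<Gamma>. countably_series_parallel (restrict_space M (S \<gamma>)) (Restr r (S \<gamma>)))) \<or>
      (\<exists>(\<Gamma> :: nat set) S. parallel_composition M r \<Gamma> S \<and>
         (\<forall>\<gamma>\<in>\<Gamma>. countably_series_parallel (restrict_space M (S \<gamma>)) (Restr r (S \<gamma>))))"
  using assms by (cases rule: countably_series_parallel.cases) blast+

lemma countably_series_parallel_measurable_poset:
  "countably_series_parallel M r \<Longrightarrow> measurable_poset M r"
  by (cases rule: countably_series_parallel.cases)
     (auto simp: series_composition_def parallel_composition_def)

text \<open>The decomposition is given over index sets in \<open>nat\<close>, as in the inductive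
  definition, while the composition rules are claimed for countable index sets in an arbitrary
  type.\<close>

theorem theorem6:
  fixes M :: "'a measure" and r :: "'a rel" and R :: ereal
  assumes "finite_measure M"
    and "countably_series_parallel M r"
    and "R = fps_conv_radius (run_le M r)"
  shows
    "(linear_order_on (space M) r \<or>
      (\<exists>(\<Gamma> :: nat set) rI S. series_composition M r \<Gamma> rI S \<and>
         (\<forall>\<gamma>\<in>\<Gamma>. countably_series_parallel (restrict_space M (S \<gamma>)) (Restr r (S \<gamma>)))) \<or>
      (\<exists>(\<Gamma> :: nat set) S. parallel_composition M r \<Gamma> S \<and>
         (\<forall>\<gamma>\<in>\<Gamma>. countably_series_parallel (restrict_space M (S \<gamma>)) (Restr r (S \<gamma>)))))
     \<and>
     (linear_order_on (space M) r \<and> \<not> degenerate M \<longrightarrow>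
       (\<forall>z. converges_at (run_lt M r) z \<and>
         (\<exists>p. enum_prod (\<lambda>\<alpha>. 1 + complex_of_real (measure M {\<alpha>}) * z) (atoms M) p \<and>
              eval_fps (run_lt M r) z = exp (complex_of_real (diffuse_mass M) * z) * p)) \<and>
       (\<forall>z. ennreal (norm z) \<le> 1 / emeasure M (space M) \<longrightarrow>
         converges_at (run_le M r) z \<and>
         (\<exists>p. enum_prod (\<lambda>\<alpha>. 1 / (1 - complex_of_real (measure M {\<alpha>}) * z)) (atoms M) p \<and>
              eval_fps (run_le M r) z = exp (complex_of_real (diffuse_mass M) * z) * p)))
     \<and>
     (\<forall>(\<Gamma> :: 'i set) rI S. countable \<Gamma> \<and> series_composition M r \<Gamma> rI S \<longrightarrow>
       (\<forall>z. converges_at (run_lt M r) z \<and>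
         (\<forall>\<gamma>\<in>\<Gamma>. converges_at (run_lt (restrict_space M (S \<gamma>)) (Restr r (S \<gamma>))) z) \<and>
         enum_prod (\<lambda>\<gamma>. eval_fps (run_lt (restrict_space M (S \<gamma>)) (Restr r (S \<gamma>))) z) \<Gamma>
           (eval_fps (run_lt M r) z)) \<and>
       (\<forall>z. ereal (norm z) < R \<longrightarrow>
         converges_at (run_le M r) z \<and>
         (\<forall>\<gamma>\<in>\<Gamma>. converges_at (run_le (restrict_space M (S \<gamma>)) (Restr r (S \<gamma>))) z) \<and>
         enum_prod (\<lambda>\<gamma>. eval_fps (run_le (restrict_space M (S \<gamma>)) (Restr r (S \<gamma>))) z) \<Gamma>
           (eval_fps (run_le M r) z)))
     \<and>
     (\<forall>(\<Gamma> :: 'i set) S. countable \<Gamma> \<and> parallel_composition M r \<Gamma> S \<longrightarrow>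
       (\<forall>z. converges_at (run_lt M r) z \<and>
         (\<forall>\<gamma>\<in>\<Gamma>. converges_at (run_lt (restrict_space M (S \<gamma>)) (Restr r (S \<gamma>))) z) \<and>
         enum_sum (\<lambda>\<gamma>. eval_fps (run_lt (restrict_space M (S \<gamma>)) (Restr r (S \<gamma>))) z - 1) \<Gamma>
           (eval_fps (run_lt M r) z - 1)) \<and>
       (\<forall>z. ereal (norm z) < R \<longrightarrow>
         converges_at (run_le M r) z \<and>
         (\<forall>\<gamma>\<in>\<Gamma>. converges_at (run_le (restrict_space M (S \<gamma>)) (Restr r (S \<gamma>))) z) \<and>
         enum_sum (\<lambda>\<gamma>. eval_fps (run_le (restrict_space M (S \<gamma>)) (Restr r (S \<gamma>))) z - 1) \<Gamma>
           (eval_fps (run_le M r) z - 1)))"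
proof -
  interpret finite_measure M by (rule assms(1))
  have M: "measurable_poset M r"
    by (rule countably_series_parallel_measurable_poset[OF assms(2)])
  then have r: "r \<in> sets (M \<Otimes>\<^sub>M M)" "r - Id \<in> sets (M \<Otimes>\<^sub>M M)" "trans r" "antisym r" "refl_on (space M) r"
    by (auto simp: measurable_poset_def partial_order_on_def preorder_on_def)
  \<comment> \<open>Antisymmetry keeps the strict relation transitive: going up and back down is
    impossible.\<close>
  have strict: "trans (r - Id)" "irrefl (r - Id)" "antisym (r - Id)"
    using r trans_diff_Id[OF r(3,4)] by (auto simp: irrefl_def antisym_def)
  have lt: "run_lt M r = chain_fps M (r - Id) (space M)"
    unfolding run_lt_eq_run_le by (rule run_le_eq_chain_fps[OF r(2)])
  have le: "run_le M r = chain_fps M r (space M)"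
    by (rule run_le_eq_chain_fps[OF r(1)])
  have lt_S: "run_lt (restrict_space M S) (Restr r S) = chain_fps M (r - Id) S" if "S \<in> sets M" for S
  proof -
    \<comment> \<open>Passing to strict order commutes with restriction to a component.\<close>
    have "Restr r S - Id = Restr (r - Id) S" by auto
    then show ?thesis unfolding run_lt_eq_run_le using run_le_restrict_space[OF r(2) that] by simp
  qed
  have le_S: "run_le (restrict_space M S) (Restr r S) = chain_fps M r S" if "S \<in> sets M" for S
    by (rule run_le_restrict_space[OF r(1) that])
  have conv_lt: "abs_converges_at (chain_fps M (r - Id) (space M)) z" for z
    by (rule abs_converges_at_strict[OF r(2) strict(1,2)])
  have conv_le: "abs_converges_at (chain_fps M r (space M)) z" if "ereal (norm z) < R" for z
    using norm_summable_fps[of z "run_le M r"] that assms(3) unfolding abs_converges_at_def le by simp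
  have conv_sub: "converges_at (chain_fps M Q S) z"
    if "abs_converges_at (chain_fps M Q (space M)) z" "S \<in> sets M" for Q S z
    by (rule abs_converges_at_imp_converges_at)
       (rule abs_converges_at_chain_fps_mono[OF that(1) sets.sets_into_space[OF that(2)]])

  have total_lt: "converges_at (run_lt M r) z \<and>
         (\<exists>p. enum_prod (\<lambda>\<alpha>. 1 + complex_of_real (measure M {\<alpha>}) * z) (atoms M) p \<and>
              eval_fps (run_lt M r) z = exp (complex_of_real (diffuse_mass M) * z) * p)"
    if lin: "linear_order_on (space M) r" for z
  proof
    show "converges_at (run_lt M r) z" unfolding lt by (rule conv_sub[OF conv_lt sets.top])
    have total: "total_on (space M) (r - Id)"
      using lin by (auto simp: linear_order_on_def total_on_def)
    have "abs_converges_at (chain_fps M (r - Id) {\<alpha>}) z"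
      "eval_fps (chain_fps M (r - Id) {\<alpha>}) z = 1 + complex_of_real (measure M {\<alpha>}) * z"
      if "\<alpha> \<in> atoms M" for \<alpha>
      using eval_chain_fps_singleton_irrefl[of \<alpha> "r - Id" z] measurable_poset_singleton[OF M, of \<alpha>] that
      by (auto simp: atoms_def)
    then show "\<exists>p. enum_prod (\<lambda>\<alpha>. 1 + complex_of_real (measure M {\<alpha>}) * z) (atoms M) p \<and>
              eval_fps (run_lt M r) z = exp (complex_of_real (diffuse_mass M) * z) * p"
      unfolding lt
      by (intro enum_prod_atoms[OF M r(2) strict(1,3) total] chain_coeff_diffuse_part(1)[OF M lin] conv_lt)
  qed

  have total_le: "converges_at (run_le M r) z \<and>
         (\<exists>p. enum_prod (\<lambda>\<alpha>. 1 / (1 - complex_of_real (measure M {\<alpha>}) * z)) (atoms M) p \<and>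
              eval_fps (run_le M r) z = exp (complex_of_real (diffuse_mass M) * z) * p)"
    if lin: "linear_order_on (space M) r" and nondeg: "\<not> degenerate M"
      and z: "ennreal (norm z) \<le> 1 / emeasure M (space M)" for z
  proof
    obtain q where q: "0 \<le> q" "q < 1" "\<And>\<alpha>. \<alpha> \<in> atoms M \<Longrightarrow> measure M {\<alpha>} * norm z \<le> q"
      using nondegenerate_atoms_bound[OF M nondeg z] by blast
    have total: "total_on (space M) r"
      using lin by (simp add: linear_order_on_def)
    have conv: "abs_converges_at (chain_fps M r (space M)) z"
      by (rule abs_converges_at_total[OF M total chain_coeff_diffuse_part(2)[OF M lin] q])
    then show "converges_at (run_le M r) z"
      unfolding le by (rule conv_sub[OF _ sets.top])
    have "abs_converges_at (chain_fps M r {\<alpha>}) z"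
      "eval_fps (chain_fps M r {\<alpha>}) z = 1 / (1 - complex_of_real (measure M {\<alpha>}) * z)"
      if "\<alpha> \<in> atoms M" for \<alpha>
      using eval_chain_fps_singleton[of \<alpha> r z] measurable_poset_singleton[OF M, of \<alpha>] r(5)
        q(2) q(3)[OF that] that
      by (auto simp: atoms_def refl_on_def)
    then show "\<exists>p. enum_prod (\<lambda>\<alpha>. 1 / (1 - complex_of_real (measure M {\<alpha>}) * z)) (atoms M) p \<and>
              eval_fps (run_le M r) z = exp (complex_of_real (diffuse_mass M) * z) * p"
      unfolding le
      by (intro enum_prod_atoms[OF M r(1,3,4) total] chain_coeff_diffuse_part(2)[OF M lin] conv)
  qed

  \<comment> \<open>\<open>Q\<close> is either the weak or the strict relation, so that one argument
    serves both run functions.\<close>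
  have series: "enum_prod (\<lambda>\<gamma>. eval_fps (chain_fps M Q (S \<gamma>)) z) \<Gamma> (eval_fps (chain_fps M Q (space M)) z)"
    if "countable \<Gamma>" and ser: "series_composition M r \<Gamma> rI S" and Q: "Q = r \<or> Q = r - Id"
      and conv: "abs_converges_at (chain_fps M Q (space M)) z"
    for \<Gamma> :: "'i set" and rI S z Q
  proof (rule enum_prod_chain_fps)
    show "Q \<in> sets (M \<Otimes>\<^sub>M M)" using Q r by auto
    show "linear_order_on \<Gamma> rI" and part: "measurable_partition M \<Gamma> S"
      using ser by (auto simp: series_composition_def)
    fix \<gamma> \<gamma>' s t assume *: "\<gamma> \<in> \<Gamma>" "\<gamma>' \<in> \<Gamma>" "\<gamma> \<noteq> \<gamma>'" "s \<in> S \<gamma>" "t \<in> S \<gamma>'"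
    \<comment> \<open>Elements of different components are distinct, so removing the diagonal leaves
      the relation between components unchanged.\<close>
    have "s \<noteq> t" using disjoint_family_onD[OF measurable_partitionD(2)[OF part] *(1-3)] *(4,5) by auto
    then show "(s, t) \<in> Q \<longleftrightarrow> (\<gamma>, \<gamma>') \<in> rI"
      using ser Q * by (auto simp: series_composition_def)
  qed (fact that)+

  have parallel: "enum_sum (\<lambda>\<gamma>. eval_fps (chain_fps M Q (S \<gamma>)) z - 1) \<Gamma> (eval_fps (chain_fps M Q (space M)) z - 1)"
    if "countable \<Gamma>" and par: "parallel_composition M r \<Gamma> S" and Q: "Q = r \<or> Q = r - Id"
      and conv: "abs_converges_at (chain_fps M Q (space M)) z"
    for \<Gamma> :: "'i set" and S z Q
  proof (rule enum_sum_chain_fps)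
    show "Q \<in> sets (M \<Otimes>\<^sub>M M)" using Q r by auto
    show "measurable_partition M \<Gamma> S"
      using par by (auto simp: parallel_composition_def)
    fix \<gamma> \<gamma>' s t assume *: "\<gamma> \<in> \<Gamma>" "\<gamma>' \<in> \<Gamma>" "\<gamma> \<noteq> \<gamma>'" "s \<in> S \<gamma>" "t \<in> S \<gamma>'"
    then show "(s, t) \<notin> Q"
      using par Q by (auto simp: parallel_composition_def)
  qed (fact that)+

  have sets_series: "S \<gamma> \<in> sets M" if "series_composition M r \<Gamma> rI S" "\<gamma> \<in> \<Gamma>" for \<Gamma> :: "'i set" and rI S \<gamma>
    using that by (auto simp: series_composition_def measurable_partition_def)
  have sets_parallel: "S \<gamma> \<in> sets M" if "parallel_composition M r \<Gamma> S" "\<gamma> \<in> \<Gamma>" for \<Gamma> :: "'i set" and S \<gamma>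
    using that by (auto simp: parallel_composition_def measurable_partition_def)

  have series_lt: "converges_at (run_lt M r) z \<and>
         (\<forall>\<gamma>\<in>\<Gamma>. converges_at (run_lt (restrict_space M (S \<gamma>)) (Restr r (S \<gamma>))) z) \<and>
         enum_prod (\<lambda>\<gamma>. eval_fps (run_lt (restrict_space M (S \<gamma>)) (Restr r (S \<gamma>))) z) \<Gamma>
           (eval_fps (run_lt M r) z)"
    if comp: "countable \<Gamma>" "series_composition M r \<Gamma> rI S" for \<Gamma> :: "'i set" and rI S z
  proof (intro conjI ballI)
    note S = sets_series[OF comp(2)]
    show "converges_at (run_lt M r) z"
      unfolding lt by (rule conv_sub[OF conv_lt sets.top])
    show "converges_at (run_lt (restrict_space M (S \<gamma>)) (Restr r (S \<gamma>))) z" if "\<gamma> \<in> \<Gamma>" for \<gamma>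
      unfolding lt_S[OF S[OF that]] by (rule conv_sub[OF conv_lt S[OF that]])
    have eq: "eval_fps (run_lt (restrict_space M (S \<gamma>)) (Restr r (S \<gamma>))) z
        = eval_fps (chain_fps M (r - Id) (S \<gamma>)) z" if "\<gamma> \<in> \<Gamma>" for \<gamma>
      unfolding lt_S[OF S[OF that]] ..
    show "enum_prod (\<lambda>\<gamma>. eval_fps (run_lt (restrict_space M (S \<gamma>)) (Restr r (S \<gamma>))) z) \<Gamma>
           (eval_fps (run_lt M r) z)"
      unfolding lt by (rule iffD2[OF enum_prod_cong[OF eq] series[OF comp(1,2) disjI2[OF refl] conv_lt]])
  qed

  have series_le: "converges_at (run_le M r) z \<and>
         (\<forall>\<gamma>\<in>\<Gamma>. converges_at (run_le (restrict_space M (S \<gamma>)) (Restr r (S \<gamma>))) z) \<and>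
         enum_prod (\<lambda>\<gamma>. eval_fps (run_le (restrict_space M (S \<gamma>)) (Restr r (S \<gamma>))) z) \<Gamma>
           (eval_fps (run_le M r) z)"
    if comp: "countable \<Gamma>" "series_composition M r \<Gamma> rI S" "ereal (norm z) < R" for \<Gamma> :: "'i set" and rI S z
  proof (intro conjI ballI)
    note S = sets_series[OF comp(2)]
    show "converges_at (run_le M r) z"
      unfolding le by (rule conv_sub[OF conv_le[OF comp(3)] sets.top])
    show "converges_at (run_le (restrict_space M (S \<gamma>)) (Restr r (S \<gamma>))) z" if "\<gamma> \<in> \<Gamma>" for \<gamma>
      unfolding le_S[OF S[OF that]] by (rule conv_sub[OF conv_le[OF comp(3)] S[OF that]])
    have eq: "eval_fps (run_le (restrict_space M (S \<gamma>)) (Restr r (S \<gamma>))) z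
        = eval_fps (chain_fps M r (S \<gamma>)) z" if "\<gamma> \<in> \<Gamma>" for \<gamma>
      unfolding le_S[OF S[OF that]] ..
    show "enum_prod (\<lambda>\<gamma>. eval_fps (run_le (restrict_space M (S \<gamma>)) (Restr r (S \<gamma>))) z) \<Gamma>
           (eval_fps (run_le M r) z)"
      unfolding le by (rule iffD2[OF enum_prod_cong[OF eq] series[OF comp(1,2) disjI1[OF refl] conv_le[OF comp(3)]]])
  qed

  have parallel_lt: "converges_at (run_lt M r) z \<and>
         (\<forall>\<gamma>\<in>\<Gamma>. converges_at (run_lt (restrict_space M (S \<gamma>)) (Restr r (S \<gamma>))) z) \<and>
         enum_sum (\<lambda>\<gamma>. eval_fps (run_lt (restrict_space M (S \<gamma>)) (Restr r (S \<gamma>))) z - 1) \<Gamma>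
           (eval_fps (run_lt M r) z - 1)"
    if comp: "countable \<Gamma>" "parallel_composition M r \<Gamma> S" for \<Gamma> :: "'i set" and S z
  proof (intro conjI ballI)
    note S = sets_parallel[OF comp(2)]
    show "converges_at (run_lt M r) z"
      unfolding lt by (rule conv_sub[OF conv_lt sets.top])
    show "converges_at (run_lt (restrict_space M (S \<gamma>)) (Restr r (S \<gamma>))) z" if "\<gamma> \<in> \<Gamma>" for \<gamma>
      unfolding lt_S[OF S[OF that]] by (rule conv_sub[OF conv_lt S[OF that]])
    have eq: "eval_fps (run_lt (restrict_space M (S \<gamma>)) (Restr r (S \<gamma>))) z - 1
        = eval_fps (chain_fps M (r - Id) (S \<gamma>)) z - 1" if "\<gamma> \<in> \<Gamma>" for \<gamma>
      unfolding lt_S[OF S[OF that]] ..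
    show "enum_sum (\<lambda>\<gamma>. eval_fps (run_lt (restrict_space M (S \<gamma>)) (Restr r (S \<gamma>))) z - 1) \<Gamma>
           (eval_fps (run_lt M r) z - 1)"
      unfolding lt by (rule iffD2[OF enum_sum_cong[OF eq] parallel[OF comp(1,2) disjI2[OF refl] conv_lt]])
  qed

  have parallel_le: "converges_at (run_le M r) z \<and>
         (\<forall>\<gamma>\<in>\<Gamma>. converges_at (run_le (restrict_space M (S \<gamma>)) (Restr r (S \<gamma>))) z) \<and>
         enum_sum (\<lambda>\<gamma>. eval_fps (run_le (restrict_space M (S \<gamma>)) (Restr r (S \<gamma>))) z - 1) \<Gamma>
           (eval_fps (run_le M r) z - 1)"
    if comp: "countable \<Gamma>" "parallel_composition M r \<Gamma> S" "ereal (norm z) < R" for \<Gamma> :: "'i set" and S z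
  proof (intro conjI ballI)
    note S = sets_parallel[OF comp(2)]
    show "converges_at (run_le M r) z"
      unfolding le by (rule conv_sub[OF conv_le[OF comp(3)] sets.top])
    show "converges_at (run_le (restrict_space M (S \<gamma>)) (Restr r (S \<gamma>))) z" if "\<gamma> \<in> \<Gamma>" for \<gamma>
      unfolding le_S[OF S[OF that]] by (rule conv_sub[OF conv_le[OF comp(3)] S[OF that]])
    have eq: "eval_fps (run_le (restrict_space M (S \<gamma>)) (Restr r (S \<gamma>))) z - 1
        = eval_fps (chain_fps M r (S \<gamma>)) z - 1" if "\<gamma> \<in> \<Gamma>" for \<gamma>
      unfolding le_S[OF S[OF that]] ..
    show "enum_sum (\<lambda>\<gamma>. eval_fps (run_le (restrict_space M (S \<gamma>)) (Restr r (S \<gamma>))) z - 1) \<Gamma>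
           (eval_fps (run_le M r) z - 1)"
      unfolding le by (rule iffD2[OF enum_sum_cong[OF eq] parallel[OF comp(1,2) disjI1[OF refl] conv_le[OF comp(3)]]])
  qed

  show ?thesis
    by (rule conjI[OF countably_series_parallel_cases[OF assms(2)] conjI[OF _ conjI]];
        intro allI impI, elim conjE, rule conjI; intro allI impI;
        rule total_lt total_le series_lt series_le parallel_lt parallel_le; assumption)
qed

end
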